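(* For any almost rational graph $\Gamma$, $\mathbb H^q(\Gamma,k)=0$ for any $q>0$ and any $k\in\mathrm{Char}$.
   Context: Graphs and lattices. $\Gamma$ is a finite connected plumbing graph (without loops) with vertex set $\mathcal J=\{1,\dots,s\}$; vertex $j$ carries an Euler number $e_j\in\mathbb Z$ and a genus $g_j\ge 0$. $L=\bigoplus_j\mathbb Z E_j$ with form $(E_j,E_j)=e_j$, $(E_i,E_j)=$ number of edges joining $i,j$ ($i\ne j$), assumed negative definite. $L'=\{l'\in L\otimes\mathbb Q:(l',l)\in\mathbb Z\ \forall l\in L\}$. $K\in L'$ is given by $(K,E_j)=-e_j-2+2g_j$ for all $j$; $\mathrm{Char}=K+2L'$. For $k\in\mathrm{Char}$, $\chi_k(l)=-(l,l+k)/2$. $L_e=\{\sum n_jE_j\in L: n_j\ge0\ \forall j\}$. Rational and almost rational graphs. A connected negative definite graph is rational if $\min_{l\in L_e\setminus 0}\chi_K(l)>0$. A connected negative definite graph $\Gamma$ which is a tree and has all $g_j=0$ is almost rational if there is a vertex $j_0\in\mathcal J$ such that replacing its Euler number $e_{j_0}$ by some integer $e'_{j_0}\le e_{j_0}$ (keeping everything else) gives a rational graph. Weights (for $k\in\mathrm{Char}$). In the cubical decomposition of $L\otimes\mathbb R=\mathbb R^s$ a $q$-cube is given by $l\in L$ and $I\subset\mathcal J$, $|I|=q$, with vertices $l+\sum_{j\in I'}E_j$, $I'\subset I$ (oriented using the order of indices); $\mathcal Q_q$ is the set of $q$-cubes. Since all $g_j=0$, the weights are $w_0(l)=\chi_k(l)$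 for $l\in L$ and $w_q(\square_q)=\max\{\chi_k(v): v\text{ a vertex of }\square_q\}$. Lattice cohomology. $\mathcal T_0^+=\mathbb Z[U,U^{-1}]/U\,\mathbb Z[U]$, $\deg U^{-d}=2d$. $\mathcal F^q=\mathrm{Hom}_{\mathbb Z}(\mathcal C_q,\mathcal T_0^+)$, $\mathcal C_q$ free on $\mathcal Q_q$. If $\partial\square_{q+1}=\sum_k\varepsilon_k\square_q^k$, then $(\delta_w\phi)(\square_{q+1})=\sum_k\varepsilon_kU^{w(\square_{q+1})-w(\square_q^k)}\phi(\square_q^k)$. $\mathbb H^q(\Gamma,k)$ is the $q$-th cohomology of $(\mathcal F^*,\delta_w)$, a $\mathbb Z[U]$-module. *)

theory Defs
  imports
    "HOL-Analysis.Analysis"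
    "HOL-Algebra.Elementary_Groups"
    "HOL-Library.Poly_Mapping"
begin

section \<open>Plumbing graphs\<close>

text \<open>
  The index set of the vertices is a finite linearly ordered type \<open>'v\<close> (so that it is nonempty and
  order isomorphic to \<open>{1, \<dots>, s}\<close> with \<open>s = CARD('v)\<close>), and \<open>edges G i j\<close> is the number of edges
  joining \<open>i\<close> and \<open>j\<close>.
\<close>

record 'v plumbing =
  edges :: "'v \<Rightarrow> 'v \<Rightarrow> nat"
  euler :: "'v \<Rightarrow> int"
  genus :: "'v \<Rightarrow> nat"

definition connected_graph :: "'v plumbing \<Rightarrow> bool" where
  "connected_graph G \<longleftrightarrow> (\<forall>i j. (i, j) \<in> {(a, b). edges G a b > 0}\<^sup>*)"

definition plumbing_graph :: "'v plumbing \<Rightarrow> bool" where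
  "plumbing_graph G \<longleftrightarrow>
     (\<forall>i j. edges G i j = edges G j i) \<and> (\<forall>i. edges G i i = 0) \<and> connected_graph G"

text \<open>
  A cycle of a loopless multigraph is either a pair of parallel edges or a closed path through at
  least three distinct vertices.
\<close>

definition acyclic_graph :: "'v plumbing \<Rightarrow> bool" where
  "acyclic_graph G \<longleftrightarrow>
     (\<forall>i j. edges G i j \<le> 1) \<and>
     \<not> (\<exists>p. 3 \<le> length p \<and> distinct p \<and>
          (\<forall>i<length p. edges G (p ! i) (p ! (Suc i mod length p)) > 0))"

definition tree_graph :: "'v plumbing \<Rightarrow> bool" where
  "tree_graph G \<longleftrightarrow> connected_graph G \<and> acyclic_graph G"


section \<open>Lattices\<close>

text \<open>
  \<open>L \<otimes> \<rat>\<close> is \<open>rat ^ 'v\<close>, with the basis vector \<open>E j\<close> belonging to the vertex \<open>j\<close>; the lattices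
  \<open>L\<close> and \<open>L'\<close> and the effective cone are subsets of it.
\<close>

definition E :: "'v \<Rightarrow> rat ^ 'v" where
  "E j = axis j 1"

definition intersection_number :: "'v plumbing \<Rightarrow> 'v \<Rightarrow> 'v \<Rightarrow> int" where
  "intersection_number G i j = (if i = j then euler G j else int (edges G i j))"

definition form :: "'v::finite plumbing \<Rightarrow> rat ^ 'v \<Rightarrow> rat ^ 'v \<Rightarrow> rat" where
  "form G x y = (\<Sum>i\<in>UNIV. \<Sum>j\<in>UNIV. of_int (intersection_number G i j) * x $ i * y $ j)"

definition lattice_L :: "(rat ^ 'v) set" where
  "lattice_L = {l. \<forall>j. l $ j \<in> \<int>}"

definition effective_L :: "(rat ^ 'v) set" where
  "effective_L = {l \<in> lattice_L. \<forall>j. l $ j \<ge> 0}"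

definition dual_L :: "'v::finite plumbing \<Rightarrow> (rat ^ 'v) set" where
  "dual_L G = {l'. \<forall>l\<in>lattice_L. form G l' l \<in> \<int>}"

definition negative_definite :: "'v::finite plumbing \<Rightarrow> bool" where
  "negative_definite G \<longleftrightarrow> (\<forall>l\<in>lattice_L - {0}. form G l l < 0)"

definition is_canonical :: "'v::finite plumbing \<Rightarrow> rat ^ 'v \<Rightarrow> bool" where
  "is_canonical G K \<longleftrightarrow> K \<in> dual_L G \<and>
     (\<forall>j. form G K (E j) = - of_int (euler G j) - 2 + 2 * of_nat (genus G j))"

text \<open>Well defined for negative definite \<open>G\<close>, see \<open>canonical_class\<close> below.\<close>

definition canonical :: "'v::finite plumbing \<Rightarrow> rat ^ 'v" where
  "canonical G = (THE K. is_canonical G K)"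

definition Char_L :: "'v::finite plumbing \<Rightarrow> (rat ^ 'v) set" where
  "Char_L G = {canonical G + 2 *s l' | l'. l' \<in> dual_L G}"

definition rr :: "'v::finite plumbing \<Rightarrow> rat ^ 'v \<Rightarrow> rat ^ 'v \<Rightarrow> rat" where
  "rr G k l = - form G l (l + k) / 2"


section \<open>Rational and almost rational graphs\<close>

definition rational_graph :: "'v::finite plumbing \<Rightarrow> bool" where
  "rational_graph G \<longleftrightarrow> plumbing_graph G \<and> negative_definite G \<and>
     (\<exists>l. is_arg_min (rr G (canonical G)) (\<lambda>x. x \<in> effective_L - {0}) l \<and>
          rr G (canonical G) l > 0)"

definition almost_rational :: "'v::finite plumbing \<Rightarrow> bool" where
  "almost_rational G \<longleftrightarrow> plumbing_graph G \<and> negative_definite G \<and> tree_graph G \<and>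
     (\<forall>j. genus G j = 0) \<and>
     (\<exists>j0. \<exists>e' \<le> euler G j0. rational_graph (G\<lparr>euler := (euler G)(j0 := e')\<rparr>))"


section \<open>The module \<open>\<T>\<^sub>0\<^sup>+\<close>\<close>

text \<open>
  Finitely supported functions from the integers to the integers, with the convolution product,
  are the Laurent polynomials over the integers; the value at \<open>n\<close> is the coefficient of \<open>U\<^sup>n\<close>.
\<close>

type_synonym laurent = "int \<Rightarrow>\<^sub>0 int"

definition U_power :: "int \<Rightarrow> laurent" where
  "U_power n = Poly_Mapping.single n 1"

definition ZU :: "laurent set" where
  "ZU = {p. \<forall>n\<in>Poly_Mapping.keys p. 0 \<le> n}"

definition U_ZU :: "laurent set" where
  "U_ZU = {U_power 1 * p | p. p \<in> ZU}"

lemma ZU_closed: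
  shows "0 \<in> ZU" and "p \<in> ZU \<Longrightarrow> - p \<in> ZU" and "p \<in> ZU \<Longrightarrow> q \<in> ZU \<Longrightarrow> p + q \<in> ZU"
    and "p \<in> ZU \<Longrightarrow> q \<in> ZU \<Longrightarrow> p * q \<in> ZU" and "U_power (int n) \<in> ZU"
proof -
  show "p \<in> ZU \<Longrightarrow> q \<in> ZU \<Longrightarrow> p + q \<in> ZU"
    using keys_add[of p q] by (auto simp: ZU_def)
  show "p \<in> ZU \<Longrightarrow> q \<in> ZU \<Longrightarrow> p * q \<in> ZU"
    using keys_mult[of p q] by (fastforce simp: ZU_def)
qed (auto simp: ZU_def U_power_def)

lemma U_ZU_closed:
  shows "0 \<in> U_ZU" and "p \<in> U_ZU \<Longrightarrow> - p \<in> U_ZU" and "p \<in> U_ZU \<Longrightarrow> q \<in> U_ZU \<Longrightarrow> p + q \<in> U_ZU"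
    and "r \<in> ZU \<Longrightarrow> p \<in> U_ZU \<Longrightarrow> r * p \<in> U_ZU"
proof -
  have I: "U_power 1 * a \<in> U_ZU" if "a \<in> ZU" for a
    using that by (auto simp: U_ZU_def)
  show "0 \<in> U_ZU"
    using I[OF ZU_closed(1)] by simp
  show "- p \<in> U_ZU" if "p \<in> U_ZU"
  proof -
    obtain a where a: "p = U_power 1 * a" "a \<in> ZU" using \<open>p \<in> U_ZU\<close> by (auto simp: U_ZU_def)
    show ?thesis using I[OF ZU_closed(2)[OF a(2)]] by (simp add: a(1))
  qed
  show "p + q \<in> U_ZU" if "p \<in> U_ZU" "q \<in> U_ZU"
  proof -
    obtain a where a: "p = U_power 1 * a" "a \<in> ZU" using \<open>p \<in> U_ZU\<close> by (auto simp: U_ZU_def)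
    obtain b where b: "q = U_power 1 * b" "b \<in> ZU" using \<open>q \<in> U_ZU\<close> by (auto simp: U_ZU_def)
    show ?thesis using I[OF ZU_closed(3)[OF a(2) b(2)]] by (simp add: a(1) b(1) distrib_left)
  qed
  show "r * p \<in> U_ZU" if "r \<in> ZU" "p \<in> U_ZU"
  proof -
    obtain a where a: "p = U_power 1 * a" "a \<in> ZU" using \<open>p \<in> U_ZU\<close> by (auto simp: U_ZU_def)
    show ?thesis using I[OF ZU_closed(4)[OF that(1) a(2)]] by (simp add: a(1) mult.left_commute)
  qed
qed

definition laurent_rel :: "laurent \<Rightarrow> laurent \<Rightarrow> bool" where
  "laurent_rel p q \<longleftrightarrow> p - q \<in> U_ZU"

quotient_type tower = laurent / laurent_rel
proof (rule equivpI)
  show "reflp laurent_rel"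
    by (auto simp: reflp_def laurent_rel_def U_ZU_closed)
  show "symp laurent_rel"
    by (fastforce simp: symp_def laurent_rel_def dest: U_ZU_closed(2))
  show "transp laurent_rel"
    by (auto simp: transp_def laurent_rel_def dest: U_ZU_closed(3))
qed

instantiation tower :: ab_group_add
begin

lift_definition zero_tower :: tower is 0 .

lift_definition plus_tower :: "tower \<Rightarrow> tower \<Rightarrow> tower" is "(+)"
  unfolding laurent_rel_def using U_ZU_closed(3) by (metis add_diff_add)

lift_definition uminus_tower :: "tower \<Rightarrow> tower" is uminus
  unfolding laurent_rel_def using U_ZU_closed(2) by (metis minus_diff_minus)

definition minus_tower :: "tower \<Rightarrow> tower \<Rightarrow> tower" where
  "minus_tower x y = x + - y"

instance
proof
  fix a b c :: tower
  show "a + b + c = a + (b + c)"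
    by transfer (simp add: laurent_rel_def U_ZU_closed add.assoc)
  show "a + b = b + a"
    by transfer (simp add: laurent_rel_def U_ZU_closed add.commute)
  show "0 + a = a"
    by transfer (simp add: laurent_rel_def U_ZU_closed)
  show "- a + a = 0"
    by transfer (simp add: laurent_rel_def U_ZU_closed)
  show "a - b = a + - b"
    by (rule minus_tower_def)
qed

end

text \<open>Multiplication by \<open>U\<^sup>n\<close>.\<close>

lift_definition U_act :: "nat \<Rightarrow> tower \<Rightarrow> tower" is "\<lambda>n p. U_power (int n) * p"
  unfolding laurent_rel_def
  using U_ZU_closed(4)[OF ZU_closed(5)] by (metis right_diff_distrib)


section \<open>Lattice cohomology\<close>

text \<open>The pair \<open>(l, I)\<close> is the cube with the vertices \<open>l + (\<Sum>j\<in>I'. E j)\<close> for \<open>I' \<subseteq> I\<close>.\<close>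

type_synonym 'v cube = "(rat ^ 'v) \<times> 'v set"

definition cubes :: "nat \<Rightarrow> 'v::finite cube set" where
  "cubes q = {(l, I). l \<in> lattice_L \<and> card I = q}"

definition cube_vertices :: "'v::finite cube \<Rightarrow> (rat ^ 'v) set" where
  "cube_vertices c = (\<lambda>I'. fst c + (\<Sum>j\<in>I'. E j)) ` Pow (snd c)"

definition weight :: "'v::finite plumbing \<Rightarrow> rat ^ 'v \<Rightarrow> 'v cube \<Rightarrow> rat" where
  "weight G k c = Max (rr G k ` cube_vertices c)"

text \<open>
  A homomorphism from the free abelian group on the \<open>q\<close>-cubes to \<open>\<T>\<^sub>0\<^sup>+\<close> is the same as a
  function on the \<open>q\<close>-cubes; as an element of a function type on all cubes it is extended by zero.
\<close>

definition cochains :: "nat \<Rightarrow> ('v::finite cube \<Rightarrow> tower) set" where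
  "cochains q = {\<phi>. \<forall>c. c \<notin> cubes q \<longrightarrow> \<phi> c = 0}"

text \<open>
  The boundary of the cube \<open>(l, I)\<close>, oriented by the order of the vertices of the graph, is
  \<open>\<Sum>j\<in>I. (-1) ^ card {i \<in> I. i < j} \<cdot> ((l + E j, I - {j}) - (l, I - {j}))\<close>.
  For \<open>k \<in> Char_L G\<close> the weights of cubes are integers, and the weight of a cube is at least that of
  each of its faces, so \<open>U_exponent\<close> is the exact difference (see \<open>weight_diff_nat\<close> below).
\<close>

definition U_exponent :: "'v::finite plumbing \<Rightarrow> rat ^ 'v \<Rightarrow> 'v cube \<Rightarrow> 'v cube \<Rightarrow> nat" where
  "U_exponent G k c d = nat \<lfloor>weight G k c - weight G k d\<rfloor>"

definition sign_act :: "nat \<Rightarrow> tower \<Rightarrow> tower" where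
  "sign_act n x = (if even n then x else - x)"

definition coboundary ::
    "'v::{finite,linorder} plumbing \<Rightarrow> (rat, 'v) vec \<Rightarrow> ('v cube \<Rightarrow> tower) \<Rightarrow> 'v cube \<Rightarrow> tower" where
  "coboundary G k \<phi> = (\<lambda>(l, I). if l \<notin> lattice_L then 0 else
     (\<Sum>j\<in>I. sign_act (card {i \<in> I. i < j})
        (U_act (U_exponent G k (l, I) (l + E j, I - {j})) (\<phi> (l + E j, I - {j}))
         - U_act (U_exponent G k (l, I) (l, I - {j})) (\<phi> (l, I - {j})))))"

definition cocycle_group ::
    "'v::{finite,linorder} plumbing \<Rightarrow> (rat, 'v) vec \<Rightarrow> nat \<Rightarrow> ('v cube \<Rightarrow> tower) monoid" where
  "cocycle_group G k q =
     \<lparr>carrier = {\<phi> \<in> cochains q. coboundary G k \<phi> = (\<lambda>_. 0)},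
      mult = (\<lambda>\<phi> \<psi> c. \<phi> c + \<psi> c), one = (\<lambda>_. 0)\<rparr>"

definition coboundaries ::
    "'v::{finite,linorder} plumbing \<Rightarrow> (rat, 'v) vec \<Rightarrow> nat \<Rightarrow> ('v cube \<Rightarrow> tower) set" where
  "coboundaries G k q = (case q of 0 \<Rightarrow> {\<lambda>_. 0} | Suc p \<Rightarrow> coboundary G k ` cochains p)"

definition lattice_cohomology ::
    "'v::{finite,linorder} plumbing \<Rightarrow> (rat, 'v) vec \<Rightarrow> nat \<Rightarrow> ('v cube \<Rightarrow> tower) set monoid" where
  "lattice_cohomology G k q = cocycle_group G k q Mod coboundaries G k q"


section \<open>Well-definedness\<close>

lemma form_add_left: "form G (x + y) z = form G x z + form G y z"
  by (simp add: form_def algebra_simps sum.distrib)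

lemma form_add_right: "form G z (x + y) = form G z x + form G z y"
  by (simp add: form_def algebra_simps sum.distrib)

lemma form_scale_left: "form G (c *s x) z = c * form G x z"
  by (simp add: form_def sum_distrib_left algebra_simps)

lemma form_scale_right: "form G z (c *s x) = c * form G z x"
  by (simp add: form_def sum_distrib_left algebra_simps)

lemma form_E_right:
  "form G x (E j) = (\<Sum>i\<in>UNIV. of_int (intersection_number G i j) * x $ i)"
  by (simp add: form_def E_def axis_def if_distrib sum.If_cases cong: if_cong)

lemma form_expand_right: "form G x y = (\<Sum>j\<in>UNIV. y $ j * form G x (E j))"
  unfolding form_E_right
  unfolding form_def
  by (subst sum.swap) (simp add: sum_distrib_left algebra_simps)

lemma common_denominator:
  fixes x :: "rat ^ 'v::finite"
  shows "\<exists>n::nat. n > 0 \<and> (of_nat n) *s x \<in> lattice_L"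
proof -
  have "\<exists>n::nat. n > 0 \<and> (\<forall>j\<in>S. of_nat n * x $ j \<in> \<int>)" if "finite S" for S
    using that
  proof (induction S rule: finite_induct)
    case empty
    show ?case by (auto intro: exI[of _ 1])
  next
    case (insert a S)
    then obtain n :: nat where n: "n > 0" "\<forall>j\<in>S. of_nat n * x $ j \<in> \<int>" by blast
    obtain p q where pq: "quotient_of (x $ a) = (p, q)" by force
    have q: "q > 0" "x $ a = of_int p / of_int q"
      using quotient_of_denom_pos[OF pq] quotient_of_div[OF pq] by auto
    have a: "of_nat (nat q * n) * x $ a = of_int (int n * p)"
      using q by (simp add: field_simps)
    have b: "of_nat (nat q * n) * x $ j \<in> \<int>" if "j \<in> S" for j
    proof -
      have "of_nat (nat q * n) * x $ j = of_nat (nat q) * (of_nat n * x $ j)"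
        by simp
      then show ?thesis using n(2) that by (metis Ints_mult Ints_of_nat)
    qed
    show ?case
      using a b n(1) q(1) by (intro exI[of _ "nat q * n"]) (auto simp del: of_nat_mult)
  qed
  from this[of UNIV] show ?thesis by (auto simp: lattice_L_def)
qed

lemma negative_definite_rat:
  assumes "negative_definite G" and "x \<noteq> 0"
  shows "form G x x < 0"
proof -
  obtain n :: nat where n: "n > 0" "of_nat n *s x \<in> lattice_L"
    using common_denominator by blast
  have "of_nat n *s x \<noteq> 0"
    using n(1) assms(2) by (simp add: vector_mul_eq_0)
  then have "form G (of_nat n *s x) (of_nat n *s x) < 0"
    using assms(1) n(2) by (auto simp: negative_definite_def)
  then have "of_nat n * (of_nat n * form G x x) < 0"
    by (simp add: form_scale_left form_scale_right)
  then show ?thesis using n(1) by (simp add: mult_less_0_iff)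
qed

lemma canonical_unique_existence:
  fixes G :: "'v::finite plumbing"
  assumes "negative_definite G"
  shows "\<exists>!K. is_canonical G K"
proof -
  define A :: "rat ^ 'v ^ 'v" where "A = (\<chi> j i. of_int (intersection_number G i j))"
  have A: "(A *v x) $ j = form G x (E j)" for x j
    by (simp add: A_def matrix_vector_mult_def form_E_right)
  have inj: "x = 0" if "A *v x = 0" for x
  proof (rule ccontr)
    assume "x \<noteq> 0"
    then have "form G x x < 0" using negative_definite_rat[OF assms] by blast
    moreover have "form G x x = 0"
      unfolding form_expand_right[of G x x] A[symmetric] that by simp
    ultimately show False by simp
  qed
  have injA: "inj ((*v) A)"
    using inj vec.linear_inj_iff_eq_0[OF matrix_vector_mul_linear_gen, of A] by blast
  then have surjA: "surj ((*v) A)"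
    using vec.linear_injective_imp_surjective[OF matrix_vector_mul_linear_gen] by blast
  obtain K where K: "A *v K = (\<chi> j. - of_int (euler G j) - 2 + 2 * of_nat (genus G j))"
    using surjA by (metis surjD)
  have KE: "form G K (E j) = - of_int (euler G j) - 2 + 2 * of_nat (genus G j)" for j
    by (simp flip: A add: K)
  have "K \<in> dual_L G"
    unfolding dual_L_def mem_Collect_eq
  proof
    fix l :: "rat ^ 'v" assume "l \<in> lattice_L"
    then show "form G K l \<in> \<int>"
      by (subst form_expand_right)
        (auto simp: KE lattice_L_def intro!: Ints_sum Ints_mult Ints_add Ints_diff Ints_minus)
  qed
  then have "is_canonical G K" by (simp add: is_canonical_def KE)
  moreover have "x = K" if "is_canonical G x" for x
  proof -
    have "A *v x = A *v K" using that by (simp add: vec_eq_iff A KE is_canonical_def)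
    then show ?thesis using injA by (simp add: inj_eq)
  qed
  ultimately show ?thesis by blast
qed

lemma canonical_class:
  assumes "negative_definite G"
  shows "is_canonical G (canonical G)"
  unfolding canonical_def by (rule theI'[OF canonical_unique_existence[OF assms]])

lemma rr_Ints:
  fixes G :: "'v::finite plumbing"
  assumes "plumbing_graph G" and "negative_definite G" and "k \<in> Char_L G" and "l \<in> lattice_L"
  shows "rr G k l \<in> \<int>"
proof -
  obtain l' where l': "l' \<in> dual_L G" and k: "k = canonical G + 2 *s l'"
    using assms(3) by (auto simp: Char_L_def)
  have canonical: "form G (canonical G) (E j) = - of_int (euler G j) - 2 + 2 * of_nat (genus G j)"
    for j
    using canonical_class[OF assms(2)] by (simp add: is_canonical_def)
  have commute: "form G x y = form G y x" for x y
    using assms(1) unfolding form_def plumbing_graph_def intersection_number_def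
    by (subst sum.swap) (auto intro!: sum.cong simp: algebra_simps)
  have add: "rr G k (x + y) = rr G k x + rr G k y - form G x y" for x y
    using commute[of x y]
    by (simp add: rr_def form_add_left form_add_right field_simps)
  have E_lattice: "E j \<in> lattice_L" for j :: 'v
    by (simp add: lattice_L_def E_def axis_def)
  have form_E_E: "form G (E j) (E j) = of_int (euler G j)" for j
    unfolding form_E_right
    by (simp add: E_def axis_def intersection_number_def if_distrib sum.If_cases cong: if_cong)
  have single: "rr G k (of_int n *s E j) \<in> \<int>" for n :: int and j
  proof -
    obtain m :: int where m: "form G l' (E j) = of_int m"
      using l' E_lattice[of j] unfolding dual_L_def by (blast elim: Ints_cases)
    have "even (n * (n - 1) * euler G j)" by simp
    then obtain d where d: "n * (n - 1) * euler G j = 2 * d" by (rule evenE)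
    have "rr G k (of_int n *s E j)
        = - (of_int (n * (n - 1) * euler G j) + 2 * of_int (n * (int (genus G j) - 1 + m))) / 2"
      by (simp add: rr_def k form_add_right form_scale_left form_scale_right form_E_E
          commute[of "E j"] canonical m algebra_simps)
    also have "\<dots> = of_int (- d - n * (int (genus G j) - 1 + m))"
      unfolding d by (simp add: field_simps)
    finally show ?thesis by simp
  qed
  have "(\<Sum>j\<in>S. l $ j *s E j) \<in> lattice_L \<and> rr G k (\<Sum>j\<in>S. l $ j *s E j) \<in> \<int>" if "finite S" for S
    using that
  proof (induction S rule: finite_induct)
    case empty
    show ?case by (simp add: lattice_L_def rr_def form_def)
  next
    case (insert a S)
    obtain n :: int where n: "l $ a = of_int n"
      using assms(4) by (auto simp: lattice_L_def elim: Ints_cases)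
    have "form G (E a) y \<in> \<int>" if "y \<in> lattice_L" for y
      unfolding commute[of "E a"] form_E_right using that
      by (auto simp: lattice_L_def intro!: Ints_sum Ints_mult)
    then have "form G (l $ a *s E a) (\<Sum>j\<in>S. l $ j *s E j) \<in> \<int>"
      using insert.IH by (simp add: form_scale_left n)
    moreover have "l $ a *s E a \<in> lattice_L"
      by (simp add: lattice_L_def E_def axis_def n)
    ultimately show ?case
      using insert single[of n a] by (auto simp: add n lattice_L_def intro!: Ints_add Ints_diff)
  qed
  moreover have "(\<Sum>j\<in>UNIV. l $ j *s E j) = l"
    by (simp add: vec_eq_iff E_def axis_def if_distrib sum.If_cases cong: if_cong)
  ultimately show ?thesis by (metis finite_class.finite_UNIV)
qed

lemma weight_diff_nat:
  assumes "plumbing_graph G" and "negative_definite G" and "k \<in> Char_L G"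
    and "l \<in> lattice_L" and "j \<in> I" and "d \<in> {(l + E j, I - {j}), (l, I - {j})}"
  shows "of_nat (U_exponent G k (l, I) d) = weight G k (l, I) - weight G k d"
proof -
  have verts_finite: "finite (rr G k ` cube_vertices c)" for c
    by (simp add: cube_vertices_def)
  have verts_nonempty: "rr G k ` cube_vertices c \<noteq> {}" for c
    by (auto simp: cube_vertices_def)
  have weight_Ints: "weight G k c \<in> \<int>" if c: "fst c \<in> lattice_L" for c
  proof -
    have "v \<in> lattice_L" if "v \<in> cube_vertices c" for v
      using that c
      by (auto simp: cube_vertices_def lattice_L_def E_def axis_def intro!: Ints_add Ints_sum)
    moreover have "weight G k c \<in> rr G k ` cube_vertices c"
      unfolding weight_def by (rule Max_in[OF verts_finite verts_nonempty])
    ultimately show ?thesis using rr_Ints[OF assms(1,2,3)] by auto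
  qed
  have shift: "(l + E j) + (\<Sum>i\<in>I'. E i) = l + (\<Sum>i\<in>insert j I'. E i)" if "I' \<subseteq> I - {j}" for I'
    using that by (subst sum.insert) (auto simp: algebra_simps)
  have "cube_vertices d \<subseteq> cube_vertices (l, I)"
  proof
    fix v assume v: "v \<in> cube_vertices d"
    show "v \<in> cube_vertices (l, I)"
    proof (cases "d = (l, I - {j})")
      case True
      then show ?thesis using v by (auto simp: cube_vertices_def)
    next
      case False
      then obtain I' where I': "I' \<subseteq> I - {j}" and "v = (l + E j) + (\<Sum>i\<in>I'. E i)"
        using v assms(6) by (auto simp: cube_vertices_def)
      then have "v = l + (\<Sum>i\<in>insert j I'. E i)" using shift by simp
      moreover have "insert j I' \<subseteq> I" using I' assms(5) by blast
      ultimately show ?thesis by (auto simp: cube_vertices_def simp del: sum.insert)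
    qed
  qed
  then have "weight G k d \<le> weight G k (l, I)"
    unfolding weight_def using verts_finite verts_nonempty by (intro Max_mono image_mono)
  moreover have "fst d \<in> lattice_L"
    using assms(4,6) by (auto simp: lattice_L_def E_def axis_def)
  then have "weight G k (l, I) - weight G k d \<in> \<int>"
    using weight_Ints assms(4) by (intro Ints_diff) auto
  ultimately show ?thesis
    unfolding U_exponent_def by (auto elim!: Ints_cases)
qed

end

theory Submission
  imports Defs
begin

text \<open>
  The lattice is fibred by the coordinate at the special vertex \<open>j0\<close>. Write \<open>k = K + 2l'\<close>. The
  fibre over \<open>n\<close> contains a base point \<open>x n\<close> with \<open>(x n + l', E j) \<le> 0\<close> for all \<open>j \<noteq> j0\<close>, chosen
  with the smallest coordinate sum. From every other point of the fibre that lies above or below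
  \<open>x n\<close>, some step by \<open>\<plusminus>E j\<close> with \<open>j \<noteq> j0\<close> leads closer to \<open>x n\<close> without increasing \<open>\<chi>\<^sub>k\<close>
  (\<open>exists_base_point\<close>, \<open>descends_if_slope_ge_1\<close>), and the same step works for the translate by
  \<open>E j0\<close> in the next fibre. Going down to \<open>x n\<close> uses almost rationality: \<open>\<chi>\<^sub>K(z)\<close> is positive for
  all effective \<open>z \<noteq> 0\<close> with coefficient zero or one at \<open>j0\<close>, because for these \<open>z\<close> it does not depend
  on the Euler number at \<open>j0\<close> (\<open>rr_canonical_euler_update\<close>).

  As the form has nonnegative entries off the diagonal, a step that is possible at a corner of a
  box is possible on the whole face of the box through this corner. So a box in a fibre
  around \<open>x n\<close>, or the slab of cubes over it that lead to the next fibre, collapses face by face without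
  increasing weights. Each collapse pairs a cube in the face with the cube that it sweeps out, which
  has the same weight, so that primitives of cocycles extend over the
  added layer with no division by \<open>U\<close> (\<open>primitives_extend_matching\<close>, \<open>primitives_extend_layer\<close>).
  Boxes exhaust the fibre, and each fibre collapses to \<open>x n\<close>, each slab to the edge from \<open>x n\<close> to
  \<open>x n + E j0\<close> (\<open>primitives_extend_fibre\<close>). Up to collapses, only a line of vertices and edges
  remains. Its first cohomology vanishes because \<open>\<T>\<^sub>0\<^sup>+\<close> is divisible by \<open>U\<close> (\<open>exists_primitive\<close>).
\<close>


section \<open>The cochain complex\<close>

lemma laurent_rel_refl: "p = q \<Longrightarrow> laurent_rel p q"
  by (simp add: laurent_rel_def U_ZU_closed)

lemma U_power_add: "U_power m * U_power n = U_power (m + n)"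
  by (simp add: U_power_def mult_single)

lemma U_act_0 [simp]: "U_act 0 x = x"
  by transfer (simp add: laurent_rel_refl U_power_def)

lemma U_act_add: "U_act n (x + y) = U_act n x + U_act n y"
  by transfer (simp add: laurent_rel_refl distrib_left)

lemma U_act_zero [simp]: "U_act n 0 = 0"
  by transfer (simp add: laurent_rel_refl)

lemma U_act_minus: "U_act n (- x) = - U_act n x"
  by transfer (simp add: laurent_rel_refl)

lemma U_act_diff: "U_act n (x - y) = U_act n x - U_act n y"
  by (simp only: minus_tower_def U_act_add U_act_minus)

lemma U_act_sum: "U_act n (\<Sum>a\<in>S. g a) = (\<Sum>a\<in>S. U_act n (g a))"
  by (induction S rule: infinite_finite_induct) (auto simp: U_act_add)

lemma U_act_U_act: "U_act m (U_act n x) = U_act (m + n) x"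
  by transfer (simp add: laurent_rel_refl U_power_add mult.assoc[symmetric])

text \<open>The module is divisible by \<open>U\<close>: \<open>U\<close> is invertible on the Laurent polynomials that it is a
  quotient of.\<close>

lemma U_act_surj: "\<exists>y. U_act n y = x"
proof (transfer fixing: n)
  fix p :: laurent
  have "U_power (int n) * (U_power (- int n) * p) = p"
    by (simp add: mult.assoc[symmetric] U_power_add) (simp add: U_power_def)
  then show "\<exists>q. laurent_rel (U_power (int n) * q) p"
    by (blast intro: laurent_rel_refl)
qed

lemma sign_act_simps:
  "sign_act n 0 = 0"
  "sign_act n (x + y) = sign_act n x + sign_act n y"
  "sign_act n (x - y) = sign_act n x - sign_act n y"
  "sign_act n (- x) = - sign_act n x"
  "sign_act m (sign_act n x) = sign_act (m + n) x"
  "sign_act (Suc n) x = - sign_act n x"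
  "U_act m (sign_act n x) = sign_act n (U_act m x)"
  by (auto simp: sign_act_def U_act_minus)

lemma sign_act_twice [simp]: "sign_act (n + n) x = x"
  by (simp add: sign_act_def)

lemma sign_act_sum: "sign_act n (\<Sum>a\<in>S. g a) = (\<Sum>a\<in>S. sign_act n (g a))"
  by (auto simp: sign_act_def sum_negf)

lemma E_in_lattice [simp]: "E j \<in> lattice_L"
  by (simp add: lattice_L_def E_def axis_def)

lemma lattice_closed [simp]:
  "x \<in> lattice_L \<Longrightarrow> y \<in> lattice_L \<Longrightarrow> x + y \<in> lattice_L"
  "x \<in> lattice_L \<Longrightarrow> y \<in> lattice_L \<Longrightarrow> x - y \<in> lattice_L"
  "x \<in> lattice_L \<Longrightarrow> - x \<in> lattice_L"
  by (auto simp: lattice_L_def)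

lemma lattice_sum_E [simp]: "(\<Sum>j\<in>S. E j) \<in> lattice_L"
  by (auto simp: lattice_L_def E_def axis_def intro!: Ints_sum)

text \<open>The codimension one faces of a cube.\<close>

definition faces :: "'v::finite cube \<Rightarrow> 'v cube set" where
  "faces c = (\<Union>j\<in>snd c. {(fst c + E j, snd c - {j}), (fst c, snd c - {j})})"

lemma faces_lattice: "d \<in> faces c \<Longrightarrow> fst c \<in> lattice_L \<Longrightarrow> fst d \<in> lattice_L"
  by (auto simp: faces_def)

lemma coboundary_apply:
  "l \<in> lattice_L \<Longrightarrow> coboundary G k \<psi> (l, I) =
     (\<Sum>j\<in>I. sign_act (card {i \<in> I. i < j})
        (U_act (U_exponent G k (l, I) (l + E j, I - {j})) (\<psi> (l + E j, I - {j}))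
         - U_act (U_exponent G k (l, I) (l, I - {j})) (\<psi> (l, I - {j}))))"
  by (simp add: coboundary_def)

lemma coboundary_outside: "l \<notin> lattice_L \<Longrightarrow> coboundary G k \<psi> (l, I) = 0"
  by (simp add: coboundary_def)

lemma coboundary_add:
  "coboundary G k (\<lambda>c. \<phi> c + \<psi> c) c = coboundary G k \<phi> c + coboundary G k \<psi> c"
  by (cases c) (auto simp: coboundary_def U_act_add sign_act_simps sum.distrib[symmetric]
      intro!: sum.cong)

lemma coboundary_diff:
  "coboundary G k (\<lambda>c. \<phi> c - \<psi> c) c = coboundary G k \<phi> c - coboundary G k \<psi> c"
  by (cases c) (auto simp: coboundary_def U_act_diff sign_act_simps sum_subtractf[symmetric]
      intro!: sum.cong)

lemma coboundary_uminus:
  "coboundary G k (\<lambda>c. - \<psi> c) c = - coboundary G k \<psi> c"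
  by (cases c) (auto simp: coboundary_def U_act_minus sign_act_simps sum_negf[symmetric]
      intro!: sum.cong)

lemma coboundary_zero: "coboundary G k (\<lambda>_. 0) = (\<lambda>_. 0)"
  by (auto simp: coboundary_def sign_act_simps)

lemma coboundary_cong:
  assumes "\<And>d. d \<in> faces c \<Longrightarrow> \<phi> d = \<psi> d"
  shows "coboundary G k \<phi> c = coboundary G k \<psi> c"
proof -
  obtain l I where c: "c = (l, I)" by fastforce
  have "\<phi> (l + E j, I - {j}) = \<psi> (l + E j, I - {j})" "\<phi> (l, I - {j}) = \<psi> (l, I - {j})"
    if "j \<in> I" for j
    using that by (auto simp: c faces_def intro!: assms)
  then show ?thesis unfolding c coboundary_def by (auto intro!: sum.cong)
qed

text \<open>A double sum that changes sign under exchanging the indices vanishes; this is the sign rule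
  behind \<open>\<delta> \<circ> \<delta> = 0\<close>.\<close>

lemma alternating_double_sum:
  fixes H :: "'v::linorder \<Rightarrow> 'v \<Rightarrow> tower"
  assumes "finite I" and "\<And>i j. H i j = H j i"
  shows "(\<Sum>j\<in>I. \<Sum>i\<in>I - {j}.
    sign_act (card {a \<in> I. a < j} + card {a \<in> I - {j}. a < i}) (H i j)) = 0"
proof -
  define n where "n j = card {a \<in> I. a < j}" for j
  define t where "t p = sign_act (n (fst p) + n (snd p)) (H (snd p) (fst p))" for p
  let ?less = "{p \<in> I \<times> I. snd p < fst p}" and ?gr = "{p \<in> I \<times> I. fst p < snd p}"
  have "(\<Sum>j\<in>I. \<Sum>i\<in>I - {j}.
      sign_act (card {a \<in> I. a < j} + card {a \<in> I - {j}. a < i}) (H i j))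
    = (\<Sum>j\<in>I. \<Sum>i\<in>I - {j}. if i < j then t (j, i) else - t (j, i))"
  proof (intro sum.cong refl)
    fix j i assume ji: "j \<in> I" "i \<in> I - {j}"
    show "sign_act (card {a \<in> I. a < j} + card {a \<in> I - {j}. a < i}) (H i j)
      = (if i < j then t (j, i) else - t (j, i))"
    proof (cases "i < j")
      case True
      then have "{a \<in> I - {j}. a < i} = {a \<in> I. a < i}" by auto
      then show ?thesis using True by (simp add: t_def n_def)
    next
      case False
      then have "{a \<in> I. a < i} = insert j {a \<in> I - {j}. a < i}" using ji by auto
      then have "n i = Suc (card {a \<in> I - {j}. a < i})"
        using assms(1) by (simp add: n_def)
      then show ?thesis using False by (simp add: t_def n_def sign_act_simps)
    qed
  qed
  also have "\<dots> = (\<Sum>p\<in>(SIGMA j:I. I - {j}). if snd p < fst p then t p else - t p)"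
    using assms(1) by (subst sum.Sigma) (auto intro!: sum.cong)
  also have "(SIGMA j:I. I - {j}) = ?less \<union> ?gr" by auto
  also have "(\<Sum>p\<in>?less \<union> ?gr. if snd p < fst p then t p else - t p)
    = (\<Sum>p\<in>?less. t p) + (\<Sum>p\<in>?gr. - t p)"
  proof (subst sum.union_disjoint)
    show "finite ?less" "finite ?gr"
      using assms(1) by (auto intro: finite_subset[of _ "I \<times> I"])
  qed (auto intro!: arg_cong2[where f = "(+)"] sum.cong)
  also have "(\<Sum>p\<in>?gr. - t p) = - (\<Sum>p\<in>?less. t p)"
    unfolding sum_negf
    by (rule arg_cong[where f = uminus], rule sum.reindex_bij_witness[of _ prod.swap prod.swap])
      (auto simp: t_def add.commute intro: assms(2) arg_cong[where f = "sign_act _"])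
  finally show ?thesis by simp
qed

text \<open>The setting of the coboundary: a negative definite plumbing graph \<open>G\<close> with a characteristic
  element \<open>k\<close>, which makes the weights integral.\<close>

locale weighted_lattice =
  fixes G :: "'v::{finite,linorder} plumbing" and k :: "(rat, 'v) vec"
  assumes plumbing: "plumbing_graph G" and negdef: "negative_definite G" and char: "k \<in> Char_L G"
begin

lemma U_exponent_face:
  assumes "fst c \<in> lattice_L" "d \<in> faces c"
  shows "of_nat (U_exponent G k c d) = weight G k c - weight G k d"
  using weight_diff_nat[OF plumbing negdef char assms(1)] assms(2)
  by (cases c) (auto simp: faces_def)

lemma U_exponent_add:
  assumes "fst c \<in> lattice_L" "d \<in> faces c" "e \<in> faces d"
  shows "U_exponent G k c d + U_exponent G k d e = U_exponent G k c e"
proof -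
  have "fst d \<in> lattice_L" by (rule faces_lattice[OF assms(2,1)])
  then have "weight G k c - weight G k e
      = of_nat (U_exponent G k c d + U_exponent G k d e)"
    using U_exponent_face assms by simp
  then show ?thesis unfolding U_exponent_def[of G k c e] by (metis floor_of_nat nat_int)
qed

lemma coboundary_coboundary: "coboundary G k (coboundary G k \<psi>) = (\<lambda>_. 0)"
proof
  fix c :: "'v cube"
  obtain l I where c: "c = (l, I)" by fastforce
  show "coboundary G k (coboundary G k \<psi>) c = 0"
  proof (cases "l \<in> lattice_L")
    case False
    then show ?thesis by (simp add: c coboundary_outside)
  next
    case l: True
    define W where "W d = U_act (U_exponent G k (l, I) d) (\<psi> d)" for d
    define H where "H i j = W (l + (E i + E j), I - {i, j}) - W (l + E i, I - {i, j})
      - (W (l + E j, I - {i, j}) - W (l, I - {i, j}))" for i j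
    have H_commute: "H i j = H j i" for i j
      unfolding H_def add.commute[of "E i"] insert_commute[of i j] by simp
    have minus2: "I - {j} - {i} = I - {j, i}" for i j
      by blast
    have W: "U_act (U_exponent G k (l, I) d) (U_act (U_exponent G k d e) (\<psi> e)) = W e"
      if "d \<in> faces (l, I)" "e \<in> faces d" for d e
      using U_exponent_add[of "(l, I)" d e] that l by (simp add: W_def U_act_U_act)
    have "coboundary G k (coboundary G k \<psi>) c = (\<Sum>j\<in>I. \<Sum>i\<in>I - {j}.
        sign_act (card {a \<in> I. a < j} + card {a \<in> I - {j}. a < i}) (H i j))"
      unfolding c
    proof (subst coboundary_apply[OF l], rule sum.cong[OF refl])
      fix j assume j: "j \<in> I"
      let ?n = "card {i \<in> I. i < j}" and ?m = "\<lambda>i. card {a \<in> I - {j}. a < i}"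
      have step: "U_act (U_exponent G k (l, I) d) (coboundary G k \<psi> d)
        = (\<Sum>i\<in>I - {j}. sign_act (?m i) (W (fst d + E i, I - {j, i}) - W (fst d, I - {j, i})))"
        if d: "d = (m, I - {j})" "d \<in> faces (l, I)" for d m
      proof -
        have "m \<in> lattice_L" using faces_lattice[OF d(2)] l by (simp add: d(1))
        moreover have "(m + E i, I - {j} - {i}) \<in> faces d" "(m, I - {j} - {i}) \<in> faces d"
          if "i \<in> I - {j}" for i
          using that by (auto simp: faces_def d(1))
        ultimately show ?thesis
          unfolding d(1) using W[OF d(2)[unfolded d(1)]]
          by (simp add: coboundary_apply U_act_sum sign_act_simps U_act_diff d(1) minus2)
      qed
      have "(l + E j, I - {j}) \<in> faces (l, I)" "(l, I - {j}) \<in> faces (l, I)"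
        using j by (auto simp: faces_def)
      note up = step[OF refl this(1)] and down = step[OF refl this(2)]
      show "sign_act ?n
          (U_act (U_exponent G k (l, I) (l + E j, I - {j})) (coboundary G k \<psi> (l + E j, I - {j}))
           - U_act (U_exponent G k (l, I) (l, I - {j})) (coboundary G k \<psi> (l, I - {j})))
        = (\<Sum>i\<in>I - {j}. sign_act (?n + ?m i) (H i j))"
        unfolding up down sum_subtractf[symmetric] sign_act_sum H_commute[of _ j]
        by (intro sum.cong refl) (simp add: sign_act_simps H_def add.assoc)
    qed
    also have "\<dots> = 0"
      by (rule alternating_double_sum) (simp_all add: H_commute)
    finally show ?thesis .
  qed
qed

text \<open>If a cochain vanishes on all but one face of a cube, and this face has the weight of the cube,
  then the coboundary on the cube is, up to sign, the value on that face.\<close>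

lemma coboundary_single_face:
  assumes l: "fst \<tau> \<in> lattice_L" and \<sigma>: "\<sigma> \<in> faces \<tau>"
    and w: "weight G k \<sigma> = weight G k \<tau>"
  obtains n where "\<And>\<psi>. (\<And>d. d \<in> faces \<tau> \<Longrightarrow> d \<noteq> \<sigma> \<Longrightarrow> \<psi> d = 0)
    \<Longrightarrow> coboundary G k \<psi> \<tau> = sign_act n (\<psi> \<sigma>)"
proof -
  obtain m I where \<tau>: "\<tau> = (m, I)" by fastforce
  obtain j where j: "j \<in> I" "\<sigma> = (m + E j, I - {j}) \<or> \<sigma> = (m, I - {j})"
    using \<sigma> by (auto simp: \<tau> faces_def)
  have E: "m + E i \<noteq> m" for i
    by (auto simp: E_def vec_eq_iff axis_def)
  have U0: "U_exponent G k (m, I) \<sigma> = 0" using w by (simp add: U_exponent_def \<tau>)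
  define n where "n = card {i \<in> I. i < j} + (if \<sigma> = (m, I - {j}) then 1 else 0)"
  have "coboundary G k \<psi> \<tau> = sign_act n (\<psi> \<sigma>)"
    if \<psi>: "\<And>d. d \<in> faces \<tau> \<Longrightarrow> d \<noteq> \<sigma> \<Longrightarrow> \<psi> d = 0" for \<psi>
  proof -
    have other: "\<psi> (m + E i, I - {i}) = 0 \<and> \<psi> (m, I - {i}) = 0" if "i \<in> I - {j}" for i
    proof -
      have "I - {i} \<noteq> I - {j}" using that j(1) by blast
      then show ?thesis using j that by (intro conjI; intro \<psi>) (auto simp: faces_def \<tau>)
    qed
    have "coboundary G k \<psi> \<tau> = sign_act (card {i \<in> I. i < j})
        (U_act (U_exponent G k (m, I) (m + E j, I - {j})) (\<psi> (m + E j, I - {j}))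
         - U_act (U_exponent G k (m, I) (m, I - {j})) (\<psi> (m, I - {j})))"
      unfolding \<tau> using l j(1) other
      by (subst coboundary_apply) (simp_all add: \<tau> sum.remove[of I j] sign_act_simps)
    also have "\<dots> = sign_act n (\<psi> \<sigma>)"
      using j(2)
    proof
      assume s: "\<sigma> = (m + E j, I - {j})"
      have "\<psi> (m, I - {j}) = 0" using j(1) E[of j] by (intro \<psi>) (auto simp: s \<tau> faces_def)
      then show ?thesis using U0 E[of j] by (simp add: s n_def)
    next
      assume s: "\<sigma> = (m, I - {j})"
      have "\<psi> (m + E j, I - {j}) = 0" using j(1) E[of j] by (intro \<psi>) (auto simp: s \<tau> faces_def)
      then show ?thesis using U0 by (simp add: s n_def sign_act_simps)
    qed
    finally show ?thesis .
  qed
  then show thesis by (rule that)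
qed

end


section \<open>Extending primitives of cocycles\<close>

text \<open>Subcomplexes of the cubical decomposition, as sets of cubes.\<close>

definition face_closed :: "'v::finite cube set \<Rightarrow> bool" where
  "face_closed A \<longleftrightarrow> (\<forall>c\<in>A. faces c \<subseteq> A)"

lemma face_closedD: "face_closed A \<Longrightarrow> c \<in> A \<Longrightarrow> d \<in> faces c \<Longrightarrow> d \<in> A"
  by (auto simp: face_closed_def)

context weighted_lattice
begin

text \<open>A function on the cubes is a primitive of \<open>\<phi>\<close> on a set of cubes. No degree is fixed, so the
  argument below treats cochains of all degrees at once.\<close>

definition primitive_on where
  "primitive_on \<phi> \<psi> A \<longleftrightarrow> (\<forall>c\<in>A. coboundary G k \<psi> c = \<phi> c)"

text \<open>The cohomological content of a collapse of \<open>B\<close> onto \<open>A\<close>: every primitive of a cocycle on \<open>A\<close>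
  extends to \<open>B\<close>. Only the values on the cubes of \<open>B - A\<close> may change. This makes the relation
  compatible with increasing unions and with extending over several sets independently.\<close>

definition primitives_extend :: "'v cube set \<Rightarrow> 'v cube set \<Rightarrow> bool" where
  "primitives_extend A B \<longleftrightarrow> A \<subseteq> B \<and>
     (\<forall>\<phi> \<psi>. coboundary G k \<phi> = (\<lambda>_. 0) \<longrightarrow> primitive_on \<phi> \<psi> A \<longrightarrow>
       (\<exists>\<psi>'. (\<forall>c. c \<notin> B - A \<longrightarrow> \<psi>' c = \<psi> c) \<and> primitive_on \<phi> \<psi>' B))"

lemma primitives_extendE:
  assumes "primitives_extend A B" "coboundary G k \<phi> = (\<lambda>_. 0)" "primitive_on \<phi> \<psi> A"
  obtains \<psi>' where "\<And>c. c \<notin> B - A \<Longrightarrow> \<psi>' c = \<psi> c" "primitive_on \<phi> \<psi>' B"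
  using assms unfolding primitives_extend_def by blast

lemma primitive_on_cong:
  assumes "face_closed A" "\<And>c. c \<in> A \<Longrightarrow> \<psi>' c = \<psi> c" "primitive_on \<phi> \<psi> A"
  shows "primitive_on \<phi> \<psi>' A"
  unfolding primitive_on_def
proof
  fix c assume c: "c \<in> A"
  have "coboundary G k \<psi>' c = coboundary G k \<psi> c"
    using assms(1,2) c by (intro coboundary_cong) (auto dest: face_closedD)
  then show "coboundary G k \<psi>' c = \<phi> c" using assms(3) c by (simp add: primitive_on_def)
qed

lemma primitives_extend_refl: "primitives_extend A A"
  unfolding primitives_extend_def by blast

lemma primitives_extend_trans:
  assumes "primitives_extend A B" "primitives_extend B C"
  shows "primitives_extend A C"
  unfolding primitives_extend_def
proof (intro conjI allI impI)
  show "A \<subseteq> C" using assms unfolding primitives_extend_def by blast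
  have sub: "A \<subseteq> B" "B \<subseteq> C" using assms unfolding primitives_extend_def by blast+
  fix \<phi> \<psi> assume \<phi>: "coboundary G k \<phi> = (\<lambda>_. 0)" and \<psi>: "primitive_on \<phi> \<psi> A"
  obtain \<psi>1 where 1: "\<And>c. c \<notin> B - A \<Longrightarrow> \<psi>1 c = \<psi> c" "primitive_on \<phi> \<psi>1 B"
    using primitives_extendE[OF assms(1) \<phi> \<psi>] by metis
  obtain \<psi>2 where 2: "\<And>c. c \<notin> C - B \<Longrightarrow> \<psi>2 c = \<psi>1 c" "primitive_on \<phi> \<psi>2 C"
    using primitives_extendE[OF assms(2) \<phi> 1(2)] by metis
  show "\<exists>\<psi>'. (\<forall>c. c \<notin> C - A \<longrightarrow> \<psi>' c = \<psi> c) \<and> primitive_on \<phi> \<psi>' C"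
  proof (intro exI[of _ \<psi>2] conjI allI impI)
    fix c assume "c \<notin> C - A"
    then have "c \<notin> C - B" "c \<notin> B - A" using sub by blast+
    then show "\<psi>2 c = \<psi> c" using 1(1) 2(1) by simp
  qed (rule 2(2))
qed

text \<open>An elementary collapse. The new cubes come in pairs of \<open>\<sigma>\<close> and \<open>\<tau> \<sigma>\<close> with \<open>\<sigma>\<close> a face of \<open>\<tau> \<sigma>\<close> of
  the same weight. The equation at \<open>\<tau> \<sigma>\<close> then determines the value of the primitive at \<open>\<sigma>\<close>, as no
  power of \<open>U\<close> has to be inverted, and the equation at \<open>\<sigma>\<close> follows from \<open>\<delta> \<circ> \<delta> = 0\<close> at \<open>\<tau> \<sigma>\<close>.\<close>

lemma primitives_extend_matching:
  assumes A: "face_closed A"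
    and new: "\<And>\<sigma>. \<sigma> \<in> N \<Longrightarrow> \<sigma> \<notin> A"
    and face: "\<And>\<sigma>. \<sigma> \<in> N \<Longrightarrow> fst (\<tau> \<sigma>) \<in> lattice_L \<and> \<sigma> \<in> faces (\<tau> \<sigma>)"
    and wt: "\<And>\<sigma>. \<sigma> \<in> N \<Longrightarrow> weight G k \<sigma> = weight G k (\<tau> \<sigma>)"
    and other: "\<And>\<sigma> d. \<sigma> \<in> N \<Longrightarrow> d \<in> faces (\<tau> \<sigma>) \<Longrightarrow> d \<noteq> \<sigma> \<Longrightarrow> d \<in> A \<union> \<tau> ` N \<and> d \<notin> N"
  shows "primitives_extend A (A \<union> N \<union> \<tau> ` N)"
  unfolding primitives_extend_def
proof (intro conjI allI impI)
  show "A \<subseteq> A \<union> N \<union> \<tau> ` N" by blast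
  fix \<phi> \<psi> assume \<phi>: "coboundary G k \<phi> = (\<lambda>_. 0)" and \<psi>: "primitive_on \<phi> \<psi> A"
  have "\<forall>\<sigma>\<in>N. \<exists>n. \<forall>\<eta>. (\<forall>d\<in>faces (\<tau> \<sigma>). d \<noteq> \<sigma> \<longrightarrow> \<eta> d = 0) \<longrightarrow>
      coboundary G k \<eta> (\<tau> \<sigma>) = sign_act n (\<eta> \<sigma>)"
    using coboundary_single_face face wt by (metis (no_types, lifting))
  then obtain n where n: "\<And>\<sigma> \<eta>. \<sigma> \<in> N \<Longrightarrow> (\<And>d. d \<in> faces (\<tau> \<sigma>) \<Longrightarrow> d \<noteq> \<sigma> \<Longrightarrow> \<eta> d = 0) \<Longrightarrow>
      coboundary G k \<eta> (\<tau> \<sigma>) = sign_act (n \<sigma>) (\<eta> \<sigma>)"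
    by metis
  \<comment> \<open>The defect of \<open>\<psi>\<close> at \<open>\<tau> \<sigma>\<close> is corrected at \<open>\<sigma>\<close>, which is a face of no cube in \<open>A\<close>.\<close>
  define \<kappa> where "\<kappa> c = (if c \<in> N then
    sign_act (n c) (\<phi> (\<tau> c) - coboundary G k \<psi> (\<tau> c)) else 0)" for c
  define \<psi>' where "\<psi>' c = \<psi> c + \<kappa> c" for c
  have eq: "\<psi>' c = \<psi> c" if "c \<notin> N" for c using that by (simp add: \<psi>'_def \<kappa>_def)
  have on_A: "primitive_on \<phi> \<psi>' A"
    using \<psi> A new by (intro primitive_on_cong[OF A _ \<psi>] eq) blast
  have on_\<tau>: "coboundary G k \<psi>' (\<tau> \<sigma>) = \<phi> (\<tau> \<sigma>)" if \<sigma>: "\<sigma> \<in> N" for \<sigma>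
  proof -
    have "coboundary G k \<kappa> (\<tau> \<sigma>) = sign_act (n \<sigma>) (\<kappa> \<sigma>)"
      using other[OF \<sigma>] by (intro n \<sigma>) (auto simp: \<kappa>_def)
    moreover have "\<kappa> \<sigma> = sign_act (n \<sigma>) (\<phi> (\<tau> \<sigma>) - coboundary G k \<psi> (\<tau> \<sigma>))"
      using \<sigma> by (simp add: \<kappa>_def)
    ultimately show ?thesis
      unfolding \<psi>'_def[abs_def] coboundary_add by (simp add: sign_act_simps(5))
  qed
  define \<rho> where "\<rho> c = \<phi> c - coboundary G k \<psi>' c" for c
  have \<rho>_closed: "coboundary G k \<rho> c = 0" for c
    unfolding \<rho>_def[abs_def] coboundary_diff by (simp add: \<phi> coboundary_coboundary)
  have on_\<sigma>: "coboundary G k \<psi>' \<sigma> = \<phi> \<sigma>" if \<sigma>: "\<sigma> \<in> N" for \<sigma>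
  proof -
    have "coboundary G k \<rho> (\<tau> \<sigma>) = sign_act (n \<sigma>) (\<rho> \<sigma>)"
    proof (intro n \<sigma>)
      fix d assume "d \<in> faces (\<tau> \<sigma>)" "d \<noteq> \<sigma>"
      then have "d \<in> A \<union> \<tau> ` N" using other[OF \<sigma>] by blast
      then show "\<rho> d = 0" using on_A on_\<tau> by (auto simp: \<rho>_def primitive_on_def)
    qed
    then show ?thesis using \<rho>_closed[of "\<tau> \<sigma>"]
      by (auto simp: \<rho>_def sign_act_def split: if_splits)
  qed
  show "\<exists>\<psi>'. (\<forall>c. c \<notin> A \<union> N \<union> \<tau> ` N - A \<longrightarrow> \<psi>' c = \<psi> c) \<and> primitive_on \<phi> \<psi>' (A \<union> N \<union> \<tau> ` N)"
  proof (intro exI[of _ \<psi>'] conjI allI impI)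
    fix c assume "c \<notin> A \<union> N \<union> \<tau> ` N - A"
    then have "c \<notin> N" using new by blast
    then show "\<psi>' c = \<psi> c" by (rule eq)
  qed (use on_A on_\<tau> on_\<sigma> in \<open>auto simp: primitive_on_def\<close>)
qed

lemma primitives_extend_chain:
  fixes A :: "nat \<Rightarrow> 'v cube set"
  assumes closed: "\<And>n. face_closed (A n)" and ext: "\<And>n. primitives_extend (A n) (A (Suc n))"
  shows "primitives_extend (A 0) (\<Union>n. A n)"
  unfolding primitives_extend_def
proof (intro conjI allI impI)
  show "A 0 \<subseteq> (\<Union>n. A n)" by blast
  fix \<phi> \<psi> assume \<phi>: "coboundary G k \<phi> = (\<lambda>_. 0)" and \<psi>: "primitive_on \<phi> \<psi> (A 0)"
  have "\<exists>\<Psi>. \<forall>n. (primitive_on \<phi> (\<Psi> n) (A n) \<and> (n = 0 \<longrightarrow> \<Psi> n = \<psi>)) \<and>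
      (\<forall>c. c \<notin> A (Suc n) - A n \<longrightarrow> \<Psi> (Suc n) c = \<Psi> n c)"
  proof (rule dependent_nat_choice)
    show "\<exists>x. primitive_on \<phi> x (A 0) \<and> (0 = (0::nat) \<longrightarrow> x = \<psi>)" using \<psi> by blast
  next
    fix x and n :: nat assume "primitive_on \<phi> x (A n) \<and> (n = 0 \<longrightarrow> x = \<psi>)"
    then obtain y where "\<And>c. c \<notin> A (Suc n) - A n \<Longrightarrow> y c = x c" "primitive_on \<phi> y (A (Suc n))"
      using primitives_extendE[OF ext \<phi>] by metis
    then show "\<exists>y. (primitive_on \<phi> y (A (Suc n)) \<and> (Suc n = 0 \<longrightarrow> y = \<psi>)) \<and>
        (\<forall>c. c \<notin> A (Suc n) - A n \<longrightarrow> y c = x c)" by blast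
  qed
  then obtain \<Psi> where \<Psi>: "\<And>n. primitive_on \<phi> (\<Psi> n) (A n)" "\<Psi> 0 = \<psi>"
    "\<And>n c. c \<notin> A (Suc n) - A n \<Longrightarrow> \<Psi> (Suc n) c = \<Psi> n c" by metis
  have mono: "A m \<subseteq> A n" if "m \<le> n" for m n
  proof -
    have "A n \<subseteq> A (Suc n)" for n using ext[of n] unfolding primitives_extend_def by blast
    then show ?thesis using that by (rule lift_Suc_mono_le)
  qed
  have stable: "\<Psi> n c = \<Psi> m c" if "m \<le> n" "c \<in> A m" for m n c
    using that(1)
  proof (induction n rule: dec_induct)
    case (step n)
    then show ?case using \<Psi>(3)[of c n] mono[of m n] that(2) by auto
  qed simp
  define \<psi>' where "\<psi>' c = (if \<exists>n. c \<in> A n then \<Psi> (LEAST n. c \<in> A n) c else \<psi> c)" for c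
  have \<psi>': "\<psi>' c = \<Psi> n c" if "c \<in> A n" for c n
  proof -
    have "(LEAST n. c \<in> A n) \<le> n" "c \<in> A (LEAST n. c \<in> A n)"
      using that by (auto intro: Least_le LeastI)
    then show ?thesis using that stable by (auto simp: \<psi>'_def)
  qed
  have "primitive_on \<phi> \<psi>' (A n)" for n
    by (rule primitive_on_cong[OF closed \<psi>' \<Psi>(1)])
  then have "primitive_on \<phi> \<psi>' (\<Union>n. A n)" by (auto simp: primitive_on_def)
  moreover have "\<psi>' c = \<psi> c" if "c \<notin> (\<Union>n. A n) - A 0" for c
    using that \<psi>'[of c 0] \<Psi>(2) by (cases "c \<in> A 0") (auto simp: \<psi>'_def)
  ultimately show "\<exists>\<psi>'. (\<forall>c. c \<notin> (\<Union>n. A n) - A 0 \<longrightarrow> \<psi>' c = \<psi> c) \<and> primitive_on \<phi> \<psi>' (\<Union>n. A n)"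
    by blast
qed

lemma primitives_extend_Union:
  assumes closed: "\<And>i. face_closed (B i)" and ext: "\<And>i. primitives_extend (A i) (B i)"
    and disj: "\<And>i j. i \<noteq> j \<Longrightarrow> (B i - A i) \<inter> B j = {}"
  shows "primitives_extend (\<Union>i. A i) (\<Union>i. B i)"
  unfolding primitives_extend_def
proof (intro conjI allI impI)
  have sub: "A i \<subseteq> B i" for i using ext by (auto simp: primitives_extend_def)
  then show "(\<Union>i. A i) \<subseteq> (\<Union>i. B i)" by blast
  fix \<phi> \<psi> assume \<phi>: "coboundary G k \<phi> = (\<lambda>_. 0)" and \<psi>: "primitive_on \<phi> \<psi> (\<Union>i. A i)"
  have "\<exists>\<psi>'. (\<forall>c. c \<notin> B i - A i \<longrightarrow> \<psi>' c = \<psi> c) \<and> primitive_on \<phi> \<psi>' (B i)" for i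
  proof -
    have "primitive_on \<phi> \<psi> (A i)" using \<psi> by (auto simp: primitive_on_def)
    then show ?thesis using primitives_extendE[OF ext \<phi>] by metis
  qed
  then obtain \<Psi> where \<Psi>: "\<And>i c. c \<notin> B i - A i \<Longrightarrow> \<Psi> i c = \<psi> c" "\<And>i. primitive_on \<phi> (\<Psi> i) (B i)"
    by metis
  define \<psi>' where "\<psi>' c = (if \<exists>i. c \<in> B i - A i then \<Psi> (THE i. c \<in> B i - A i) c else \<psi> c)" for c
  have new: "\<psi>' c = \<Psi> i c" if c: "c \<in> B i - A i" for c i
  proof -
    have "(THE i. c \<in> B i - A i) = i" using c disj by (intro the_equality) blast+
    then show ?thesis using c by (auto simp: \<psi>'_def)
  qed
  have \<psi>': "\<psi>' c = \<Psi> i c" if c: "c \<in> B i" for c i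
  proof (cases "c \<in> B i - A i")
    case False
    then have "c \<notin> B j - A j" for j using c disj[of j i] by (cases "j = i") auto
    then show ?thesis using \<Psi>(1)[OF False] by (auto simp: \<psi>'_def)
  qed (rule new)
  have "primitive_on \<phi> \<psi>' (B i)" for i
    by (rule primitive_on_cong[OF closed \<psi>' \<Psi>(2)])
  then have "primitive_on \<phi> \<psi>' (\<Union>i. B i)" by (auto simp: primitive_on_def)
  moreover have "\<psi>' c = \<psi> c" if c: "c \<notin> (\<Union>i. B i) - (\<Union>i. A i)" for c
  proof (cases "\<exists>i. c \<in> B i - A i")
    case True
    then obtain i j where ij: "c \<in> B i - A i" "c \<in> A j" using c by blast
    then have "i \<noteq> j" by blast
    then have "c \<notin> B j" using disj[of i j] ij(1) by blast
    then show ?thesis using sub[of j] ij(2) by blast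
  next
    case False
    then show ?thesis unfolding \<psi>'_def by (simp only: if_False)
  qed
  ultimately show "\<exists>\<psi>'. (\<forall>c. c \<notin> (\<Union>i. B i) - (\<Union>i. A i) \<longrightarrow> \<psi>' c = \<psi> c)
      \<and> primitive_on \<phi> \<psi>' (\<Union>i. B i)" by blast
qed

end


section \<open>Adding a layer of lattice points\<close>

lemma E_nth: "E j $ i = (if i = j then 1 else 0)"
  by (simp add: E_def axis_def)

lemma cube_vertices_iff: "v \<in> cube_vertices (l, I) \<longleftrightarrow> (\<exists>S\<subseteq>I. v = l + (\<Sum>j\<in>S. E j))"
  by (auto simp: cube_vertices_def)

lemma base_in_cube_vertices: "l \<in> cube_vertices (l, I)"
  unfolding cube_vertices_iff by (intro exI[of _ "{}"]) simp

lemma cube_vertices_nth: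
  assumes "v \<in> cube_vertices (l, I)" "j \<notin> I"
  shows "v $ j = l $ j"
proof -
  obtain S where "S \<subseteq> I" "v = l + (\<Sum>j\<in>S. E j)" using assms(1) by (auto simp: cube_vertices_iff)
  moreover have "(\<Sum>i\<in>S. E i $ j) = (0::rat)"
    using \<open>S \<subseteq> I\<close> assms(2) by (intro sum.neutral) (auto simp: E_nth)
  ultimately show ?thesis by (simp add: sum_component)
qed

lemma cube_vertices_insert:
  assumes "j \<notin> I"
  shows "cube_vertices (l, insert j I) = cube_vertices (l, I) \<union> cube_vertices (l + E j, I)"
proof -
  have "l + (\<Sum>i\<in>insert j S. E i) = l + E j + (\<Sum>i\<in>S. E i)" if "S \<subseteq> I" for S
    using that assms by (subst sum.insert) auto
  then have "cube_vertices (l, insert j I)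
      = cube_vertices (l, I) \<union> (\<lambda>S. l + E j + (\<Sum>i\<in>S. E i)) ` Pow I"
    by (auto simp: cube_vertices_def Pow_insert image_Un image_image simp del: sum.insert
        intro!: image_cong)
  then show ?thesis by (simp add: cube_vertices_def)
qed

lemma cube_vertices_translate: "v + x \<in> cube_vertices (l + x, I) \<longleftrightarrow> v \<in> cube_vertices (l, I)"
  by (auto simp: cube_vertices_iff algebra_simps)

lemma cube_vertices_split:
  assumes "v \<in> cube_vertices (l, I)"
  obtains u S where "u \<in> cube_vertices (l, I - J)" "S \<subseteq> I \<inter> J" "v = u + (\<Sum>j\<in>S. E j)"
proof -
  obtain S where S: "S \<subseteq> I" "v = l + (\<Sum>j\<in>S. E j)" using assms by (auto simp: cube_vertices_iff)
  have "(\<Sum>j\<in>S. E j) = (\<Sum>j\<in>S - J. E j) + (\<Sum>j\<in>S \<inter> J. E j)"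
    by (subst sum.union_disjoint[symmetric]) (auto intro!: sum.cong)
  moreover have "l + (\<Sum>j\<in>S - J. E j) \<in> cube_vertices (l, I - J)"
    unfolding cube_vertices_iff using S(1) by blast
  moreover have "S \<inter> J \<subseteq> I \<inter> J" using S(1) by blast
  ultimately show ?thesis using that S(2) by (metis add.assoc)
qed

lemma weight_eqI:
  assumes "cube_vertices c \<subseteq> cube_vertices d"
    and "\<And>v. v \<in> cube_vertices d \<Longrightarrow> \<exists>u\<in>cube_vertices c. rr G k v \<le> rr G k u"
  shows "weight G k c = weight G k d"
proof -
  have fin: "finite (cube_vertices c)" "finite (cube_vertices d)"
    and ne: "cube_vertices c \<noteq> {}" "cube_vertices d \<noteq> {}"
    by (auto simp: cube_vertices_def)
  show ?thesis
    unfolding weight_def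
  proof (rule antisym)
    show "Max (rr G k ` cube_vertices c) \<le> Max (rr G k ` cube_vertices d)"
      using fin ne assms(1) by (intro Max_mono) auto
    show "Max (rr G k ` cube_vertices d) \<le> Max (rr G k ` cube_vertices c)"
    proof (rule Max.boundedI)
      fix x assume "x \<in> rr G k ` cube_vertices d"
      then obtain u where "u \<in> cube_vertices c" "x \<le> rr G k u" using assms(2) by blast
      then show "x \<le> Max (rr G k ` cube_vertices c)"
        using fin by (intro order_trans[OF _ Max_ge[of _ "rr G k u"]]) auto
    qed (use fin ne in auto)
  qed
qed

text \<open>The cubes whose part in the direction of \<open>j0\<close> is \<open>T\<close>, either \<open>{}\<close> or \<open>{j0}\<close>, and whose face in
  the other directions has all its vertices in \<open>V\<close>. If \<open>V\<close> is the part of the lattice on which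
  the coordinate at \<open>j0\<close> is \<open>n\<close>, then these are the cubes of a fibre of the projection to this
  coordinate for \<open>T = {}\<close>, and the cubes over the interval from \<open>n\<close> to \<open>n + 1\<close>, a slab, for
  \<open>T = {j0}\<close>.\<close>

definition cells :: "'v \<Rightarrow> 'v set \<Rightarrow> (rat ^ 'v) set \<Rightarrow> 'v::finite cube set" where
  "cells j0 T V = {(l, I). l \<in> lattice_L \<and> I \<inter> {j0} = T \<and> cube_vertices (l, I - {j0}) \<subseteq> V}"

lemma faces_cells:
  assumes "c \<in> cells j0 T V" "d \<in> faces c"
  shows "d \<in> cells j0 T V \<or> (T = {j0} \<and> d \<in> cells j0 {} lattice_L)"
proof -
  obtain l I j where c: "c = (l, I)" "j \<in> I" and d: "d = (l + E j, I - {j}) \<or> d = (l, I - {j})"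
    using assms(2) by (cases c) (auto simp: faces_def)
  have l: "l \<in> lattice_L" "I \<inter> {j0} = T" "cube_vertices (l, I - {j0}) \<subseteq> V"
    using assms(1) by (auto simp: cells_def c)
  have all: "cube_vertices (m, J) \<subseteq> lattice_L" if "m \<in> lattice_L" for m J
    using that by (auto simp: cube_vertices_iff)
  show ?thesis
  proof (cases "j = j0")
    case True
    have "T = {j0}" using l(2) c(2) True by blast
    moreover have "d \<in> cells j0 {} lattice_L"
      using d l(1) True all[of "l + E j"] all[of l] by (elim disjE) (simp_all add: cells_def)
    ultimately show ?thesis by blast
  next
    case False
    have *: "insert j (I - {j} - {j0}) = I - {j0}" using c(2) False by blast
    have "cube_vertices (l, I - {j0})
        = cube_vertices (l, I - {j} - {j0}) \<union> cube_vertices (l + E j, I - {j} - {j0})"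
      unfolding *[symmetric] by (rule cube_vertices_insert) simp
    then show ?thesis using d l False by (auto simp: cells_def)
  qed
qed

lemma face_closed_cells: "face_closed (cells j0 {} V)"
  unfolding face_closed_def using faces_cells[of _ j0 "{}" V] by blast

lemma face_closed_cells': "face_closed (cells j0 {} lattice_L \<union> cells j0 {j0} V)"
  unfolding face_closed_def
  using faces_cells[of _ j0 "{}" lattice_L] faces_cells[of _ j0 "{j0}" V] by blast

context weighted_lattice
begin

text \<open>A layer of points \<open>v\<close> with \<open>v $ j = m\<close> at the boundary of \<open>V\<close> can be removed if moving it one step
  into \<open>V\<close> does not increase the weights. A cube \<open>\<sigma>\<close> in the layer is paired with the cube that it
  sweeps out; the weight of the latter is attained on \<open>\<sigma>\<close>. The vertices of the slab cubes are the
  \<open>v + (\<Sum>i\<in>S. E i)\<close> with \<open>S \<subseteq> T\<close>.\<close>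

lemma primitives_extend_layer:
  fixes V :: "(rat, 'v) vec set" and s m :: rat
  assumes j: "j \<noteq> j0" and s: "s = 1 \<or> s = -1"
    and inw: "\<And>v. v \<in> V \<Longrightarrow> v $ j = m \<Longrightarrow> v + s *s E j \<in> V"
    and out: "\<And>v. v \<in> V \<Longrightarrow> v $ j = m \<Longrightarrow> v - s *s E j \<notin> V"
    and wt: "\<And>v S. v \<in> V \<Longrightarrow> v $ j = m \<Longrightarrow> S \<subseteq> T \<Longrightarrow>
      rr G k (v + (\<Sum>i\<in>S. E i) + s *s E j) \<le> rr G k (v + (\<Sum>i\<in>S. E i))"
    and R: "R \<inter> cells j0 T V = {}" "face_closed (R \<union> cells j0 T V)"
      "face_closed (R \<union> cells j0 T {v \<in> V. v $ j \<noteq> m})"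
  shows "primitives_extend (R \<union> cells j0 T {v \<in> V. v $ j \<noteq> m}) (R \<union> cells j0 T V)"
proof -
  define V' where "V' = {v \<in> V. v $ j \<noteq> m}"
  define N where "N = {(l, I) \<in> cells j0 T V. j \<notin> I \<and> l $ j = m}"
  \<comment> \<open>The lower corner of the cube swept out by a cube at \<open>l\<close> that moves by \<open>s *s E j\<close>.\<close>
  define b where "b l = (if s = 1 then l else l - E j)" for l :: "(rat, 'v) vec"
  define \<tau> where "\<tau> c = (b (fst c), insert j (snd c))" for c :: "'v cube"
  have b: "(b l = l \<and> b l + E j = l + s *s E j) \<or> (b l = l + s *s E j \<and> b l + E j = l)" for l
    using s by (elim disjE) (simp_all add: b_def)
  have b_L: "b l \<in> lattice_L" if "l \<in> lattice_L" for l using that by (auto simp: b_def)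
  have verts: "cube_vertices (b l, insert j I)
      = cube_vertices (l, I) \<union> cube_vertices (l + s *s E j, I)" if "j \<notin> I" for l I
    using b[of l] unfolding cube_vertices_insert[OF that] by (metis Un_commute)
  have \<tau>_cells: "\<tau> c \<in> cells j0 T V" if "c \<in> N" for c
  proof -
    obtain l I where c: "c = (l, I)" by fastforce
    have l: "l \<in> lattice_L" "I \<inter> {j0} = T" "cube_vertices (l, I - {j0}) \<subseteq> V" "j \<notin> I" "l $ j = m"
      using that by (auto simp: N_def c cells_def)
    have "cube_vertices (l + s *s E j, I - {j0}) \<subseteq> V"
    proof
      fix v assume "v \<in> cube_vertices (l + s *s E j, I - {j0})"
      then have *: "v - s *s E j \<in> cube_vertices (l, I - {j0})"
        using cube_vertices_translate[of "v - s *s E j" "s *s E j"] by simp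
      then have "(v - s *s E j) $ j = m" using cube_vertices_nth[OF *] l by auto
      then show "v \<in> V" using inw[of "v - s *s E j"] * l(3) by auto
    qed
    moreover have "insert j I - {j0} = insert j (I - {j0})" using j by auto
    ultimately show ?thesis
      using l b_L verts[of "I - {j0}" l] j by (auto simp: \<tau>_def c cells_def)
  qed
  have decompose: "c \<in> cells j0 T V' \<union> N \<union> \<tau> ` N" if "c \<in> cells j0 T V" for c
  proof -
    obtain l I where c: "c = (l, I)" by fastforce
    have l: "l \<in> lattice_L" "I \<inter> {j0} = T" "cube_vertices (l, I - {j0}) \<subseteq> V"
      using that by (auto simp: c cells_def)
    show ?thesis
    proof (cases "j \<in> I")
      case False
      then have "v $ j = l $ j" if "v \<in> cube_vertices (l, I - {j0})" for v
        using that False by (intro cube_vertices_nth[of v l "I - {j0}"]) auto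
      then show ?thesis using False l that by (auto simp: c N_def V'_def cells_def)
    next
      case True
      let ?J = "I - {j} - {j0}"
      have I: "insert j ?J = I - {j0}" "insert j (I - {j}) = I" using True j by blast+
      have v: "cube_vertices (l, I - {j0}) = cube_vertices (l, ?J) \<union> cube_vertices (l + E j, ?J)"
        unfolding I(1)[symmetric] by (rule cube_vertices_insert) simp
      have V: "l \<in> V" "l + E j \<in> V"
        using l(3) base_in_cube_vertices[of l ?J] base_in_cube_vertices[of "l + E j" ?J]
        unfolding v by blast+
      consider "l $ j = m" | "(l + E j) $ j = m" | "l $ j \<noteq> m" "(l + E j) $ j \<noteq> m" by blast
      then show ?thesis
      proof cases
        case 1
        then have "s = 1" using s out[OF V(1)] V(2) by (auto simp: vector_smult_lneg)
        then have "\<tau> (l, I - {j}) = c" using True by (simp add: \<tau>_def b_def insert_absorb c)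
        moreover have "(l, I - {j}) \<in> N" using 1 l j v by (auto simp: N_def cells_def)
        ultimately show ?thesis by blast
      next
        case 2
        then have "s = -1" using s out[OF V(2)] V(1) by auto
        then have "\<tau> (l + E j, I - {j}) = c" using True by (simp add: \<tau>_def b_def insert_absorb c)
        moreover have "(l + E j, I - {j}) \<in> N" using 2 l j v by (auto simp: N_def cells_def)
        ultimately show ?thesis by blast
      next
        case 3
        have "u $ j \<noteq> m" if "u \<in> cube_vertices (l, I - {j0})" for u
          using that 3 cube_vertices_nth[of u l ?J j] cube_vertices_nth[of u "l + E j" ?J j]
          unfolding v by auto
        then show ?thesis using l by (auto simp: c V'_def cells_def)
      qed
    qed
  qed
  have N_cells: "N \<subseteq> cells j0 T V" by (auto simp: N_def)
  have "primitives_extend (R \<union> cells j0 T V') (R \<union> cells j0 T V' \<union> N \<union> \<tau> ` N)"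
  proof (rule primitives_extend_matching)
    show "face_closed (R \<union> cells j0 T V')" using R(3) by (simp add: V'_def)
  next
    fix \<sigma> assume \<sigma>: "\<sigma> \<in> N"
    obtain l I where lI: "\<sigma> = (l, I)" by fastforce
    have l: "l \<in> lattice_L" "I \<inter> {j0} = T" "cube_vertices (l, I - {j0}) \<subseteq> V" "j \<notin> I" "l $ j = m"
      using \<sigma> by (auto simp: N_def lI cells_def)
    show "\<sigma> \<notin> R \<union> cells j0 T V'"
      using R(1) N_cells \<sigma> base_in_cube_vertices[of l "I - {j0}"] l(5)
      by (auto simp: lI cells_def V'_def)
    have face: "\<sigma> \<in> faces (\<tau> \<sigma>)" using b[of l] l(4) by (auto simp: faces_def \<tau>_def lI)
    then show "fst (\<tau> \<sigma>) \<in> lattice_L \<and> \<sigma> \<in> faces (\<tau> \<sigma>)" using b_L l by (simp add: \<tau>_def lI)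
    show "weight G k \<sigma> = weight G k (\<tau> \<sigma>)"
    proof (rule weight_eqI)
      show "cube_vertices \<sigma> \<subseteq> cube_vertices (\<tau> \<sigma>)" using verts[OF l(4)] by (auto simp: \<tau>_def lI)
      fix v assume "v \<in> cube_vertices (\<tau> \<sigma>)"
      then consider "v \<in> cube_vertices \<sigma>" | "v \<in> cube_vertices (l + s *s E j, I)"
        using verts[OF l(4)] by (auto simp: \<tau>_def lI)
      then show "\<exists>u\<in>cube_vertices \<sigma>. rr G k v \<le> rr G k u"
      proof cases
        case 2
        then have *: "v - s *s E j \<in> cube_vertices (l, I)"
          using cube_vertices_translate[of "v - s *s E j" "s *s E j"] by simp
        then obtain u S where u: "u \<in> cube_vertices (l, I - {j0})" "S \<subseteq> I \<inter> {j0}"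
          "v - s *s E j = u + (\<Sum>j\<in>S. E j)" by (rule cube_vertices_split)
        have "u $ j = m" using cube_vertices_nth[OF u(1)] l by auto
        moreover have "u \<in> V" "S \<subseteq> T" using u l by blast+
        ultimately have "rr G k (v - s *s E j + s *s E j) \<le> rr G k (v - s *s E j)"
          unfolding u(3) by (intro wt)
        then have "rr G k v \<le> rr G k (v - s *s E j)" by simp
        then show ?thesis using * by (auto simp: lI)
      qed blast
    qed
    fix d assume d: "d \<in> faces (\<tau> \<sigma>)" "d \<noteq> \<sigma>"
    have "d \<notin> N"
    proof
      assume dN: "d \<in> N"
      then have "j \<notin> snd d" "fst d $ j = m" by (auto simp: N_def)
      then have "d = (l + s *s E j, I)"
        using d b[of l] l(4) by (auto simp: faces_def \<tau>_def lI)
      then show False using \<open>fst d $ j = m\<close> l(5) s by (auto simp: E_nth)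
    qed
    moreover have "d \<in> R \<union> cells j0 T V"
      using face_closedD[OF R(2) _ d(1)] \<tau>_cells[OF \<sigma>] by blast
    ultimately show "d \<in> R \<union> cells j0 T V' \<union> \<tau> ` N \<and> d \<notin> N" using decompose by blast
  qed
  moreover have "cells j0 T V' \<subseteq> cells j0 T V" by (auto simp: cells_def V'_def)
  then have "R \<union> cells j0 T V' \<union> N \<union> \<tau> ` N = R \<union> cells j0 T V"
    using decompose N_cells \<tau>_cells by blast
  ultimately show ?thesis by (simp add: V'_def)
qed

end


section \<open>The intersection form and the slopes of the weight function\<close>

lemma form_commute:
  assumes "plumbing_graph G"
  shows "form G x y = form G y x"
  using assms unfolding form_def plumbing_graph_def intersection_number_def
  by (subst sum.swap) (auto intro!: sum.cong simp: algebra_simps)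

lemma form_minus_left: "form G (- x) y = - form G x y"
  using form_scale_left[of G "-1" x y] by simp

lemma form_diff_left: "form G (x - y) z = form G x z - form G y z"
  using form_add_left[of G x "- y" z] by (simp add: form_minus_left)

lemma form_E_E: "form G (E j) (E j) = of_int (euler G j)"
  unfolding form_E_right
  by (simp add: E_def axis_def intersection_number_def if_distrib sum.If_cases cong: if_cong)

lemma form_nonneg:
  assumes "\<And>i. 0 \<le> x $ i" "\<And>i. 0 \<le> y $ i" "\<And>i. x $ i = 0 \<or> y $ i = 0"
  shows "0 \<le> form G x y"
  unfolding form_def
proof (intro sum_nonneg)
  fix i j
  show "0 \<le> of_int (intersection_number G i j) * x $ i * y $ j"
    using assms(1,2)[of i] assms(1,2)[of j] assms(3)[of i]
    by (cases "i = j") (auto simp: intersection_number_def)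
qed

lemma ex_min_Ints:
  fixes f :: "'a \<Rightarrow> rat"
  assumes "S \<noteq> {}" "\<And>x. x \<in> S \<Longrightarrow> f x \<in> \<int>" "\<And>x. x \<in> S \<Longrightarrow> b \<le> f x"
  obtains c where "c \<in> S" "\<And>x. x \<in> S \<Longrightarrow> f c \<le> f x"
proof -
  define m where "m x = nat (\<lfloor>f x\<rfloor> - \<lfloor>b\<rfloor>)" for x
  obtain a where "a \<in> S" using assms(1) by blast
  then obtain c where c: "c \<in> S" "\<And>y. y \<in> S \<Longrightarrow> m c \<le> m y"
    using ex_has_least_nat[of "\<lambda>x. x \<in> S" a m] by blast
  have "f c \<le> f x" if x: "x \<in> S" for x
  proof -
    have "\<lfloor>b\<rfloor> \<le> \<lfloor>f c\<rfloor>" "\<lfloor>b\<rfloor> \<le> \<lfloor>f x\<rfloor>" using assms(3) c(1) x by (auto intro: floor_mono)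
    then have "\<lfloor>f c\<rfloor> \<le> \<lfloor>f x\<rfloor>" using c(2)[OF x] by (simp add: m_def)
    then show ?thesis using assms(2)[OF c(1)] assms(2)[OF x] by (auto elim!: Ints_cases)
  qed
  then show ?thesis using c(1) that by blast
qed

lemma canonical_in_Char: "canonical G \<in> Char_L G"
proof -
  have "0 \<in> dual_L G" by (simp add: dual_L_def form_def)
  moreover have "canonical G = canonical G + 2 *s 0" by simp
  ultimately show ?thesis unfolding Char_L_def by blast
qed

lemma Ints_less_le: "(a::rat) \<in> \<int> \<Longrightarrow> b \<in> \<int> \<Longrightarrow> a < b \<Longrightarrow> a + 1 \<le> b"
  by (auto elim!: Ints_cases)

lemma lattice_nth: "l \<in> lattice_L \<Longrightarrow> l $ j \<in> \<int>"
  by (simp add: lattice_L_def)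

context weighted_lattice
begin

text \<open>The change of the Riemann-Roch function along \<open>E j\<close>. It equals \<open>1 - (l + l', E j)\<close> if \<open>g\<^sub>j = 0\<close> and
  \<open>k = K + 2l'\<close>, so \<open>1 \<le> slope l j\<close> is the condition \<open>(l + l', E j) \<le> 0\<close>.\<close>

definition slope :: "(rat, 'v) vec \<Rightarrow> 'v \<Rightarrow> rat" where
  "slope l j = rr G k (l + E j) - rr G k l"

lemma slope_eq: "slope l j = - form G l (E j) - of_int (euler G j) / 2 - form G k (E j) / 2"
  by (simp add: slope_def rr_def form_add_left form_add_right form_E_E
      form_commute[OF plumbing, of "E j"] field_simps)

lemma slope_add: "slope (l + x) j = slope l j - form G x (E j)"
  by (simp add: slope_eq form_add_left)

lemma slope_Ints: "l \<in> lattice_L \<Longrightarrow> slope l j \<in> \<int>"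
  by (simp add: slope_def rr_Ints[OF plumbing negdef char])

text \<open>The slope at a corner of a box controls the slopes on the whole face through it.\<close>

lemma slope_antimono:
  assumes "\<And>i. u $ i \<le> v $ i" "u $ j = v $ j"
  shows "slope v j \<le> slope u j"
proof -
  have "0 \<le> form G (v - u) (E j)"
    using assms by (intro form_nonneg) (auto simp: E_nth)
  then show ?thesis using slope_add[of u "v - u" j] by simp
qed

lemma rr_bounded_below: "form G k k / 8 \<le> rr G k l"
proof -
  \<comment> \<open>Completing the square.\<close>
  define h where "h = (1 / 2) *s k"
  have h: "k = h + h" by (simp add: h_def vec_eq_iff)
  have "form G (l + h) (l + h) \<le> 0"
    using negative_definite_rat[OF negdef, of "l + h"] by (cases "l + h = 0") (auto simp: form_def)
  moreover have "form G k k = form G h h + form G h h + (form G h h + form G h h)"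
    "form G l k = form G l h + form G l h"
    unfolding h form_add_left form_add_right by (rule refl)+
  ultimately show ?thesis
    by (simp add: rr_def form_add_left form_add_right form_commute[OF plumbing, of h l])
qed

text \<open>Points with prescribed upper bounds for the products with the \<open>E j\<close> exist above any given point:
  a minimum over a set closed under adding \<open>E j\<close> has nonnegative slope in this direction. The
  function to minimise is the Riemann-Roch function of the canonical class for other genera, which
  are chosen to give its linear part the required coefficients.\<close>

lemma exists_form_le:
  fixes m :: "'v \<Rightarrow> int"
  assumes b: "b \<in> lattice_L"
  obtains c where "c \<in> lattice_L" "c $ j0 = b $ j0" "\<And>i. b $ i \<le> c $ i"
    "\<And>j. j \<noteq> j0 \<Longrightarrow> form G c (E j) \<le> of_int (m j)"
proof -
  define H where "H = G\<lparr>genus := \<lambda>j. nat (1 - m j)\<rparr>"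
  have form_H: "form H = form G"
  proof -
    have "intersection_number H = intersection_number G"
      by (intro ext) (simp add: intersection_number_def H_def)
    then show ?thesis by (intro ext) (simp add: form_def)
  qed
  have pl: "plumbing_graph H"
    using plumbing by (simp add: plumbing_graph_def connected_graph_def H_def)
  have nd: "negative_definite H" using negdef by (simp add: negative_definite_def form_H)
  interpret H: weighted_lattice H "canonical H"
    using pl nd canonical_in_Char by unfold_locales
  define S where "S = {c \<in> lattice_L. c $ j0 = b $ j0 \<and> (\<forall>i. b $ i \<le> c $ i)}"
  have "S \<noteq> {}" using b by (auto simp: S_def)
  moreover have "rr H (canonical H) x \<in> \<int>" if "x \<in> S" for x
    using that by (intro rr_Ints pl nd canonical_in_Char) (simp add: S_def)
  ultimately obtain c where c: "c \<in> S" "\<And>x. x \<in> S \<Longrightarrow> rr H (canonical H) c \<le> rr H (canonical H) x"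
    using ex_min_Ints[OF _ _ H.rr_bounded_below] by metis
  show thesis
  proof
    show "c \<in> lattice_L" "c $ j0 = b $ j0" "\<And>i. b $ i \<le> c $ i" using c(1) by (auto simp: S_def)
    fix j assume j: "j \<noteq> j0"
    have "c + E j \<in> S" using c(1) j by (auto simp: S_def E_nth add_increasing2)
    then have "0 \<le> H.slope c j" using c(2) by (simp add: H.slope_def)
    moreover have "form H (canonical H) (E j) = - of_int (euler H j) - 2 + 2 * of_nat (genus H j)"
      using canonical_class[OF nd] by (simp add: is_canonical_def)
    moreover have "genus H j = nat (1 - m j)" by (simp add: H_def)
    ultimately have "form G c (E j) \<le> 1 - of_nat (nat (1 - m j))"
      by (simp add: H.slope_eq form_H)
    also have "1 - of_nat (nat (1 - m j)) \<le> (of_int (m j) :: rat)"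
    proof -
      have "1 - int (nat (1 - m j)) \<le> m j" by simp
      then have "of_int (1 - int (nat (1 - m j))) \<le> (of_int (m j) :: rat)"
        by (simp only: of_int_le_iff)
      then show ?thesis unfolding of_int_diff of_int_1 of_int_of_nat_eq .
    qed
    finally show "form G c (E j) \<le> of_int (m j)" .
  qed
qed

lemma exists_slope_ge_1:
  assumes b: "b \<in> lattice_L"
  obtains c where "c \<in> lattice_L" "c $ j0 = b $ j0" "\<And>i. b $ i \<le> c $ i"
    "\<And>j. j \<noteq> j0 \<Longrightarrow> 1 \<le> slope c j"
proof -
  define r where "r j = - 1 - of_int (euler G j) / 2 - form G k (E j) / 2" for j
  obtain c where c: "c \<in> lattice_L" "c $ j0 = b $ j0" "\<And>i. b $ i \<le> c $ i"
    "\<And>j. j \<noteq> j0 \<Longrightarrow> form G c (E j) \<le> of_int \<lfloor>r j\<rfloor>"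
    using exists_form_le[OF b, of j0 "\<lambda>j. \<lfloor>r j\<rfloor>"] by metis
  have "1 \<le> slope c j" if "j \<noteq> j0" for j
  proof -
    have "form G c (E j) \<le> r j" using c(4)[OF that] of_int_floor_le order_trans by blast
    then show ?thesis by (simp add: slope_eq r_def)
  qed
  then show ?thesis using that c by blast
qed

lemma exists_slope_le_0:
  assumes a: "a \<in> lattice_L"
  obtains d where "d \<in> lattice_L" "d $ j0 = a $ j0" "\<And>i. d $ i \<le> a $ i"
    "\<And>j. j \<noteq> j0 \<Longrightarrow> slope d j \<le> 0"
proof -
  define r where "r j = of_int (euler G j) / 2 + form G k (E j) / 2" for j
  have "- a \<in> lattice_L" using a by simp
  then obtain c where c: "c \<in> lattice_L" "c $ j0 = (- a) $ j0" "\<And>i. (- a) $ i \<le> c $ i"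
    "\<And>j. j \<noteq> j0 \<Longrightarrow> form G c (E j) \<le> of_int \<lfloor>r j\<rfloor>"
    using exists_form_le[of "- a" j0 "\<lambda>j. \<lfloor>r j\<rfloor>"] by metis
  have "slope (- c) j \<le> 0" if "j \<noteq> j0" for j
  proof -
    have "form G c (E j) \<le> r j" using c(4)[OF that] of_int_floor_le order_trans by blast
    then show ?thesis by (simp add: slope_eq r_def form_minus_left)
  qed
  moreover have "(- c) $ i \<le> a $ i" for i using c(3)[of i] by simp
  ultimately show ?thesis using that[of "- c"] c by simp
qed

text \<open>If the nonnegative vector \<open>x\<close> has only nonnegative products with the \<open>E j\<close> in its support,
  then it vanishes.\<close>

lemma eq_0_if_form_nonneg:
  assumes "\<And>j. 0 \<le> x $ j" "\<And>j. x $ j > 0 \<Longrightarrow> 0 \<le> form G x (E j)"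
  shows "x = 0"
proof (rule ccontr)
  assume "x \<noteq> 0"
  then have "form G x x < 0" by (rule negative_definite_rat[OF negdef])
  moreover have "0 \<le> form G x x"
    unfolding form_expand_right[of G x x]
  proof (intro sum_nonneg)
    fix j show "0 \<le> x $ j * form G x (E j)" using assms[of j] by (cases "x $ j = 0") auto
  qed
  ultimately show False by simp
qed

text \<open>From every point strictly below \<open>p\<close> in its fibre there is a step towards \<open>p\<close> that does not
  increase the weight.\<close>

definition ascends :: "'v \<Rightarrow> (rat, 'v) vec \<Rightarrow> bool" where
  "ascends j0 p \<longleftrightarrow> (\<forall>a\<in>lattice_L. a $ j0 = p $ j0 \<longrightarrow> (\<forall>i. a $ i \<le> p $ i) \<longrightarrow> a \<noteq> p \<longrightarrow>
     (\<exists>j. j \<noteq> j0 \<and> a $ j < p $ j \<and> slope a j \<le> 0))"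

text \<open>From every point \<open>c\<close> strictly above \<open>p\<close> in its fibre there is a step towards \<open>p\<close> that does not
  increase the weight. It is required for the translate \<open>c + E j0\<close> in the next fibre; it then
  follows for \<open>c\<close>, as slopes are antitone, so that one step serves both ends of a slab.\<close>

definition descends :: "'v \<Rightarrow> (rat, 'v) vec \<Rightarrow> bool" where
  "descends j0 p \<longleftrightarrow> (\<forall>c\<in>lattice_L. c $ j0 = p $ j0 \<longrightarrow> (\<forall>i. p $ i \<le> c $ i) \<longrightarrow> c \<noteq> p \<longrightarrow>
     (\<exists>j. j \<noteq> j0 \<and> p $ j < c $ j \<and> 0 \<le> slope (c + E j0 - E j) j))"

lemma ascends_if_slope_le_0:
  assumes "\<And>j. j \<noteq> j0 \<Longrightarrow> slope d j \<le> 0"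
  shows "ascends j0 d"
  unfolding ascends_def
proof (intro ballI impI)
  fix a assume a: "a \<in> lattice_L" "a $ j0 = d $ j0" "\<forall>i. a $ i \<le> d $ i" "a \<noteq> d"
  show "\<exists>j. j \<noteq> j0 \<and> a $ j < d $ j \<and> slope a j \<le> 0"
  proof (rule ccontr)
    assume neg: "\<not> ?thesis"
    have "d - a = 0"
    proof (rule eq_0_if_form_nonneg)
      fix j assume "(d - a) $ j > 0"
      then have j: "a $ j < d $ j" by simp
      then have "j \<noteq> j0" using a(2) by auto
      then have "slope a j > 0" "slope d j \<le> 0" using neg j assms by auto
      then show "0 \<le> form G (d - a) (E j)" using slope_add[of a "d - a" j] by simp
    qed (use a(3) in auto)
    then show False using a(4) by simp
  qed
qed

text \<open>The coordinate sums of the points of a fibre with all slopes at least one are bounded below: such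
  points lie above any point \<open>d\<close> with nonpositive slopes. One with the smallest sum can be reached
  from below.\<close>

lemma exists_base_point:
  obtains x where "x \<in> lattice_L" "x $ j0 = of_int n"
    "\<And>j. j \<noteq> j0 \<Longrightarrow> 1 \<le> slope x j" "ascends j0 x"
proof -
  define S where "S = {c \<in> lattice_L. c $ j0 = of_int n \<and> (\<forall>j. j \<noteq> j0 \<longrightarrow> 1 \<le> slope c j)}"
  define b :: "(rat, 'v) vec" where "b = of_int n *s E j0"
  have b: "b \<in> lattice_L" "b $ j0 = of_int n" by (auto simp: b_def lattice_L_def E_nth)
  obtain d where d: "d \<in> lattice_L" "d $ j0 = of_int n" "\<And>j. j \<noteq> j0 \<Longrightarrow> slope d j \<le> 0"
    using exists_slope_le_0[OF b(1), of j0] b(2) by metis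
  obtain c where "c \<in> lattice_L" "c $ j0 = b $ j0" "\<And>j. j \<noteq> j0 \<Longrightarrow> 1 \<le> slope c j"
    using exists_slope_ge_1[OF b(1), of j0] by metis
  then have "c \<in> S" by (simp add: S_def b(2))
  then have "S \<noteq> {}" by blast
  have d_le: "d $ i \<le> c $ i" if c: "c \<in> S" for c i
  proof -
    define u where "u = (\<chi> i. max 0 (c $ i - d $ i))"
    define w where "w = (\<chi> i. max 0 (d $ i - c $ i))"
    have uw: "c = d + u - w" by (simp add: vec_eq_iff u_def w_def max_def)
    have "w = 0"
    proof (rule eq_0_if_form_nonneg)
      fix j assume j: "w $ j > 0"
      then have "d $ j \<noteq> c $ j" by (auto simp: w_def)
      then have "j \<noteq> j0" using c d(2) by (auto simp: S_def)
      then have "slope d j \<le> 0" "1 \<le> slope c j" using d(3) c by (auto simp: S_def)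
      moreover have "slope c j = slope d j - form G (u - w) (E j)"
        using slope_add[of d "u - w" j] by (simp add: uw add_diff_eq)
      moreover have "0 \<le> form G u (E j)"
        using j by (intro form_nonneg) (auto simp: u_def w_def E_nth)
      ultimately show "0 \<le> form G w (E j)" by (simp add: form_diff_left)
    qed (simp add: w_def)
    then have "w $ i = 0" by simp
    then show ?thesis by (simp add: w_def)
  qed
  obtain x where x: "x \<in> S" "\<And>c. c \<in> S \<Longrightarrow> (\<Sum>i\<in>UNIV. x $ i) \<le> (\<Sum>i\<in>UNIV. c $ i)"
  proof (rule ex_min_Ints[OF \<open>S \<noteq> {}\<close>, of "\<lambda>c. \<Sum>i\<in>UNIV. c $ i" "\<Sum>i\<in>UNIV. d $ i"])
    show "(\<Sum>i\<in>UNIV. c $ i) \<in> \<int>" if "c \<in> S" for c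
      using that by (auto simp: S_def intro!: Ints_sum lattice_nth)
    show "(\<Sum>i\<in>UNIV. d $ i) \<le> (\<Sum>i\<in>UNIV. c $ i)" if "c \<in> S" for c
      using d_le[OF that] by (intro sum_mono)
  qed blast
  have "ascends j0 x"
    unfolding ascends_def
  proof (intro ballI impI)
    fix a assume a: "a \<in> lattice_L" "a $ j0 = x $ j0" "\<forall>i. a $ i \<le> x $ i" "a \<noteq> x"
    obtain i where "a $ i \<noteq> x $ i" using a(4) by (auto simp: vec_eq_iff)
    then have "(\<Sum>i\<in>UNIV. a $ i) < (\<Sum>i\<in>UNIV. x $ i)"
      using a(3) by (intro sum_strict_mono_ex1) (auto intro!: exI[of _ i] simp: less_le)
    then have "a \<notin> S" using x(2) by fastforce
    then obtain j where j: "j \<noteq> j0" "slope a j < 1" using a x(1) by (auto simp: S_def)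
    have "slope a j \<le> 0"
      using Ints_less_le[OF slope_Ints[OF a(1)] Ints_1 j(2)] by simp
    moreover have "a $ j < x $ j"
    proof (rule ccontr)
      assume "\<not> a $ j < x $ j"
      then have "slope x j \<le> slope a j" using a(3) by (intro slope_antimono) (auto intro: antisym)
      moreover have "1 \<le> slope x j" using x(1) j(1) by (simp add: S_def)
      ultimately show False using j(2) by simp
    qed
    ultimately show "\<exists>j. j \<noteq> j0 \<and> a $ j < x $ j \<and> slope a j \<le> 0" using j(1) by blast
  qed
  then show thesis using that x(1) by (auto simp: S_def)
qed

end

text \<open>What is used of almost rationality. For \<open>z\<close> with coefficient zero or one at \<open>j0\<close>, the value
  \<open>\<chi>\<^sub>K(z)\<close> does not depend on the Euler number at \<open>j0\<close>.\<close>

locale almost_rational_weights = weighted_lattice +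
  fixes j0 :: 'a
  assumes genus_0: "\<And>j. genus G j = 0"
    and rr_pos: "\<And>z. z \<in> effective_L - {0} \<Longrightarrow> z $ j0 = 0 \<or> z $ j0 = 1 \<Longrightarrow> 0 < rr G (canonical G) z"
begin

lemma form_canonical: "form G (canonical G) (E j) = - of_int (euler G j) - 2"
  using canonical_class[OF negdef] genus_0 by (simp add: is_canonical_def)

text \<open>This is where almost rationality enters. Let \<open>c = p + z\<close>. If no step is possible at \<open>c\<close>, then
  \<open>(z + E j0 + K, E j) \<ge> 0\<close> for all \<open>j\<close> in the support of \<open>z\<close>, so that \<open>(z + E j0 + K, z) \<ge> 0\<close>. This
  contradicts \<open>\<chi>\<^sub>K(z) > 0\<close> and \<open>\<chi>\<^sub>K(z + E j0) \<ge> 1\<close>, since \<open>\<chi>\<^sub>K(E j0) = 1\<close> and \<open>(z, E j0) \<ge> 0\<close>.\<close>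

lemma descends_if_slope_ge_1:
  assumes p: "p \<in> lattice_L" "\<And>j. j \<noteq> j0 \<Longrightarrow> 1 \<le> slope p j"
  shows "descends j0 p"
  unfolding descends_def
proof (intro ballI impI)
  fix c assume c: "c \<in> lattice_L" "c $ j0 = p $ j0" "\<forall>i. p $ i \<le> c $ i" "c \<noteq> p"
  define z where "z = c - p"
  let ?K = "canonical G"
  have z: "z \<in> effective_L - {0}" "z $ j0 = 0"
    using c p(1) by (auto simp: z_def effective_L_def)
  have zE: "z + E j0 \<in> effective_L - {0}" "(z + E j0) $ j0 = 1"
    using z by (auto simp: effective_L_def E_nth vec_eq_iff intro!: exI[of _ j0])
  have E0: "form G (E j0) ?K = - of_int (euler G j0) - 2"
    using form_canonical form_commute[OF plumbing] by metis
  have zK: "form G ?K z = form G z ?K" "form G (E j0) z = form G z (E j0)"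
    by (rule form_commute[OF plumbing])+
  have "0 < rr G ?K z" using rr_pos z by blast
  then have 1: "form G z z + form G z ?K < 0" by (simp add: rr_def form_add_right)
  have "0 < rr G ?K (z + E j0)" using rr_pos zE by blast
  moreover have "rr G ?K (z + E j0) \<in> \<int>"
    using zE(1) by (intro rr_Ints plumbing negdef canonical_in_Char) (simp add: effective_L_def)
  ultimately have "1 \<le> rr G ?K (z + E j0)" using Ints_less_le[of 0 "rr G ?K (z + E j0)"] by simp
  then have 2: "form G z z + form G z ?K + 2 * form G z (E j0) \<le> 0"
    by (simp add: rr_def form_add_left form_add_right E0 form_E_E zK field_simps)
  have 3: "0 \<le> form G z (E j0)"
    using z by (intro form_nonneg) (auto simp: effective_L_def E_nth)
  show "\<exists>j. j \<noteq> j0 \<and> p $ j < c $ j \<and> 0 \<le> slope (c + E j0 - E j) j"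
  proof (rule ccontr)
    assume neg: "\<not> ?thesis"
    have "0 \<le> z $ j * form G (z + E j0 + ?K) (E j)" for j
    proof (cases "z $ j = 0")
      case False
      then have j: "p $ j < c $ j" "j \<noteq> j0"
        using c(2,3) z(2) by (auto simp: z_def order.strict_iff_order)
      have "slope (c + E j0 - E j) j < 0" using neg j by auto
      then have "slope (c + E j0 - E j) j + 1 \<le> 0"
        using c(1) by (intro Ints_less_le slope_Ints) auto
      moreover have "slope (c + E j0 - E j) j
          = slope p j - form G (z + E j0) (E j) + of_int (euler G j)"
        using slope_add[of p "z + E j0 - E j" j]
        by (simp add: z_def form_add_left form_diff_left form_E_E algebra_simps)
      ultimately have "0 \<le> form G (z + E j0 + ?K) (E j)"
        using p(2)[OF j(2)] by (simp add: form_add_left form_canonical)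
      then show ?thesis using z(1) by (auto simp: effective_L_def)
    qed simp
    then have "0 \<le> form G (z + E j0 + ?K) z"
      unfolding form_expand_right[of G _ z] by (intro sum_nonneg)
    then show False using 1 2 3 by (simp add: form_add_left zK)
  qed
qed

end


section \<open>Collapsing the fibres and the slabs\<close>

text \<open>The lattice points between \<open>a\<close> and \<open>c\<close> in the fibre of \<open>a\<close>.\<close>

definition lattice_box :: "'v \<Rightarrow> (rat ^ 'v) \<Rightarrow> (rat ^ 'v) \<Rightarrow> (rat ^ 'v) set" where
  "lattice_box j0 a c = {l \<in> lattice_L. l $ j0 = a $ j0 \<and> (\<forall>i. a $ i \<le> l $ i \<and> l $ i \<le> c $ i)}"

text \<open>The lattice points with coordinate \<open>n\<close> at \<open>j0\<close>.\<close>

definition fibre :: "'v \<Rightarrow> rat \<Rightarrow> (rat ^ 'v) set" where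
  "fibre j0 n = {l \<in> lattice_L. l $ j0 = n}"

text \<open>The cubes that are present from the beginning when the cubes of type \<open>T\<close> are collapsed: the slabs
  are collapsed relative to all fibres.\<close>

definition kept :: "'v \<Rightarrow> 'v set \<Rightarrow> 'v::finite cube set" where
  "kept j0 T = (if T = {} then {} else cells j0 {} lattice_L)"

lemma kept_disjoint: "kept j0 T \<inter> cells j0 T V = {}"
  by (auto simp: kept_def cells_def)

lemma face_closed_kept:
  assumes "T = {} \<or> T = {j0}"
  shows "face_closed (kept j0 T \<union> cells j0 T V)"
  using assms face_closed_cells[of j0 V] face_closed_cells'[of j0 V] by (auto simp: kept_def)

lemma sum_E_subset_singleton:
  assumes "S \<subseteq> {j0}" "j \<noteq> j0"
  shows "(\<Sum>i\<in>S. E i) $ j = 0" "0 \<le> (\<Sum>i\<in>S. E i) $ i" "(\<Sum>i\<in>S. E i) $ i \<le> E j0 $ i"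
proof -
  have "S = {} \<or> S = {j0}" using assms(1) by blast
  then show "(\<Sum>i\<in>S. E i) $ j = 0" "0 \<le> (\<Sum>i\<in>S. E i) $ i" "(\<Sum>i\<in>S. E i) $ i \<le> E j0 $ i"
    using assms(2) by (auto simp: E_nth)
qed

lemma cells_singleton_box:
  assumes "x \<in> lattice_L" "T = {} \<or> T = {j0}"
  shows "cells j0 T (lattice_box j0 x x) = {(x, T)}"
proof -
  have lattice_box: "lattice_box j0 x x = {x}"
    using assms(1) by (auto simp: lattice_box_def vec_eq_iff order_eq_iff)
  have "(l, I) \<in> cells j0 T {x} \<longleftrightarrow> l = x \<and> I = T" for l I
  proof
    assume "(l, I) \<in> cells j0 T {x}"
    then have l: "I \<inter> {j0} = T" "cube_vertices (l, I - {j0}) \<subseteq> {x}" by (auto simp: cells_def)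
    have "l = x" using l(2) base_in_cube_vertices[of l "I - {j0}"] by blast
    moreover have "j \<notin> I - {j0}" for j
    proof
      assume "j \<in> I - {j0}"
      then have "l + E j \<in> cube_vertices (l, I - {j0})"
        unfolding cube_vertices_iff by (intro exI[of _ "{j}"]) simp
      then have "l + E j = l" using l(2) \<open>l = x\<close> by blast
      then have "E j $ j = (0::rat)" by simp
      then show False by (simp add: E_nth)
    qed
    ultimately show "l = x \<and> I = T" using l(1) by blast
  next
    assume "l = x \<and> I = T"
    then show "(l, I) \<in> cells j0 T {x}"
      using assms by (auto simp: cells_def cube_vertices_iff)
  qed
  then show ?thesis unfolding lattice_box by auto
qed

context weighted_lattice
begin

text \<open>The box shrinks from its upper corner \<open>c\<close> to \<open>p\<close>, one face at a time.\<close>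

lemma primitives_extend_up:
  assumes T: "T = {} \<or> T = {j0}" and p: "p \<in> lattice_L" "descends j0 p"
    and a: "\<And>i. a $ i \<le> p $ i" "a $ j0 = p $ j0"
    and c: "c \<in> lattice_L" "c $ j0 = p $ j0" "\<And>i. p $ i \<le> c $ i"
  shows "primitives_extend (kept j0 T \<union> cells j0 T (lattice_box j0 a p))
    (kept j0 T \<union> cells j0 T (lattice_box j0 a c))"
  using c
proof (induction "nat \<lfloor>\<Sum>i\<in>UNIV. c $ i - p $ i\<rfloor>" arbitrary: c rule: less_induct)
  case (less c)
  show ?case
  proof (cases "c = p")
    case True
    then show ?thesis by (simp add: primitives_extend_refl)
  next
    case False
    then obtain j where j: "j \<noteq> j0" "p $ j < c $ j" "0 \<le> slope (c + E j0 - E j) j"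
      using p(2) less.prems unfolding descends_def by blast
    let ?c = "c - E j"
    have pj: "p $ j + 1 \<le> c $ j" by (intro Ints_less_le lattice_nth p less.prems j)
    have c': "?c \<in> lattice_L" "?c $ j0 = p $ j0" "\<And>i. p $ i \<le> ?c $ i"
      using less.prems pj j(1) by (auto simp: E_nth)
    have "(\<Sum>i\<in>UNIV. ?c $ i - p $ i) = (\<Sum>i\<in>UNIV. c $ i - p $ i) - (\<Sum>i\<in>UNIV. E j $ i)"
      unfolding sum_subtractf[symmetric] by (intro sum.cong) auto
    also have "(\<Sum>i\<in>UNIV. E j $ i) = (1::rat)" by (simp add: E_nth)
    finally have s: "(\<Sum>i\<in>UNIV. ?c $ i - p $ i) = (\<Sum>i\<in>UNIV. c $ i - p $ i) - 1" .
    moreover have "0 \<le> (\<Sum>i\<in>UNIV. ?c $ i - p $ i)" using c'(3) by (intro sum_nonneg) simp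
    ultimately have "nat \<lfloor>\<Sum>i\<in>UNIV. ?c $ i - p $ i\<rfloor> < nat \<lfloor>\<Sum>i\<in>UNIV. c $ i - p $ i\<rfloor>"
      by linarith
    then have 1: "primitives_extend (kept j0 T \<union> cells j0 T (lattice_box j0 a p))
        (kept j0 T \<union> cells j0 T (lattice_box j0 a ?c))"
      using c' by (rule less.hyps)
    \<comment> \<open>The face of the box through the corner \<open>c\<close> is moved by \<open>- E j\<close>.\<close>
    have remove: "{v \<in> lattice_box j0 a c. v $ j \<noteq> c $ j} = lattice_box j0 a ?c"
    proof (intro equalityI subsetI)
      fix v assume v: "v \<in> {v \<in> lattice_box j0 a c. v $ j \<noteq> c $ j}"
      then have "v $ j + 1 \<le> c $ j"
        using less.prems(1) by (intro Ints_less_le lattice_nth) (auto simp: lattice_box_def less_le)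
      then show "v \<in> lattice_box j0 a ?c" using v by (auto simp: lattice_box_def E_nth)
    next
      fix v assume v: "v \<in> lattice_box j0 a ?c"
      have "v $ i \<le> c $ i" for i
      proof -
        have "v $ i \<le> ?c $ i" using v unfolding lattice_box_def by blast
        also have "\<dots> \<le> c $ i" by (simp add: E_nth)
        finally show ?thesis .
      qed
      moreover have "v $ j \<le> ?c $ j" using v unfolding lattice_box_def by blast
      then have "v $ j \<noteq> c $ j" by (simp add: E_nth)
      ultimately show "v \<in> {v \<in> lattice_box j0 a c. v $ j \<noteq> c $ j}" using v by (auto simp: lattice_box_def)
    qed
    have "primitives_extend (kept j0 T \<union> cells j0 T {v \<in> lattice_box j0 a c. v $ j \<noteq> c $ j})
        (kept j0 T \<union> cells j0 T (lattice_box j0 a c))"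
    proof (rule primitives_extend_layer[where s = "-1"])
      fix v assume v: "v \<in> lattice_box j0 a c" "v $ j = c $ j"
      have "a $ i \<le> (v - E j) $ i \<and> (v - E j) $ i \<le> c $ i" for i
      proof -
        have "a $ i \<le> v $ i" "v $ i \<le> c $ i" "a $ i \<le> p $ i" using v(1) a(1) by (auto simp: lattice_box_def)
        then show ?thesis using pj v(2) by (cases "i = j") (auto simp: E_nth)
      qed
      then show "v + (- 1) *s E j \<in> lattice_box j0 a c" using v j(1) by (auto simp: lattice_box_def E_nth)
      show "v - (- 1) *s E j \<notin> lattice_box j0 a c"
        using v(2) by (auto simp: lattice_box_def E_nth intro!: exI[of _ j])
      fix S assume S: "S \<subseteq> T"
      then have S0: "S \<subseteq> {j0}" using T by blast
      define e where "e = (\<Sum>i\<in>S. E i)"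
      have e: "e $ j = 0" "e $ i \<le> E j0 $ i" for i
        using sum_E_subset_singleton[OF S0 j(1)] by (simp_all add: e_def)
      let ?w = "v + e - E j"
      have "slope (c + E j0 - E j) j \<le> slope ?w j"
      proof (rule slope_antimono)
        fix i
        have "v $ i \<le> c $ i" using v(1) unfolding lattice_box_def by blast
        then show "?w $ i \<le> (c + E j0 - E j) $ i" using e(2)[of i] by simp
      qed (use v(2) e(1) j(1) in \<open>simp add: E_nth\<close>)
      then have "0 \<le> slope ?w j" using j(3) by simp
      then show "rr G k (v + (\<Sum>i\<in>S. E i) + (- 1) *s E j) \<le> rr G k (v + (\<Sum>i\<in>S. E i))"
        by (simp add: slope_def e_def)
    qed (use j(1) T in \<open>auto simp: kept_disjoint face_closed_kept\<close>)
    then show ?thesis using 1 unfolding remove by (blast intro: primitives_extend_trans)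
  qed
qed

text \<open>The box shrinks from its lower corner \<open>a\<close> to \<open>p\<close>, one face at a time.\<close>

lemma primitives_extend_down:
  assumes T: "T = {} \<or> T = {j0}" and p: "p \<in> lattice_L" "ascends j0 p"
    and c: "\<And>i. p $ i \<le> c $ i"
    and a: "a \<in> lattice_L" "a $ j0 = p $ j0" "\<And>i. a $ i \<le> p $ i"
  shows "primitives_extend (kept j0 T \<union> cells j0 T (lattice_box j0 p c))
    (kept j0 T \<union> cells j0 T (lattice_box j0 a c))"
  using a
proof (induction "nat \<lfloor>\<Sum>i\<in>UNIV. p $ i - a $ i\<rfloor>" arbitrary: a rule: less_induct)
  case (less a)
  show ?case
  proof (cases "a = p")
    case True
    then show ?thesis by (simp add: primitives_extend_refl)
  next
    case False
    then obtain j where j: "j \<noteq> j0" "a $ j < p $ j" "slope a j \<le> 0"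
      using p(2) less.prems unfolding ascends_def by blast
    let ?a = "a + E j"
    have pj: "a $ j + 1 \<le> p $ j" by (intro Ints_less_le lattice_nth p less.prems j)
    have a': "?a \<in> lattice_L" "?a $ j0 = p $ j0" "\<And>i. ?a $ i \<le> p $ i"
      using less.prems pj j(1) by (auto simp: E_nth)
    have "(\<Sum>i\<in>UNIV. p $ i - ?a $ i) = (\<Sum>i\<in>UNIV. p $ i - a $ i) - (\<Sum>i\<in>UNIV. E j $ i)"
      unfolding sum_subtractf[symmetric] by (intro sum.cong) auto
    also have "(\<Sum>i\<in>UNIV. E j $ i) = (1::rat)" by (simp add: E_nth)
    finally have s: "(\<Sum>i\<in>UNIV. p $ i - ?a $ i) = (\<Sum>i\<in>UNIV. p $ i - a $ i) - 1" .
    moreover have "0 \<le> (\<Sum>i\<in>UNIV. p $ i - ?a $ i)" using a'(3) by (intro sum_nonneg) simp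
    ultimately have "nat \<lfloor>\<Sum>i\<in>UNIV. p $ i - ?a $ i\<rfloor> < nat \<lfloor>\<Sum>i\<in>UNIV. p $ i - a $ i\<rfloor>"
      by linarith
    then have 1: "primitives_extend (kept j0 T \<union> cells j0 T (lattice_box j0 p c))
        (kept j0 T \<union> cells j0 T (lattice_box j0 ?a c))"
      using a' by (rule less.hyps)
    \<comment> \<open>The face of the box through the corner \<open>a\<close> is moved by \<open>E j\<close>.\<close>
    have remove: "{v \<in> lattice_box j0 a c. v $ j \<noteq> a $ j} = lattice_box j0 ?a c"
    proof (intro equalityI subsetI)
      fix v assume v: "v \<in> {v \<in> lattice_box j0 a c. v $ j \<noteq> a $ j}"
      then have "a $ j \<le> v $ j" "a $ j \<noteq> v $ j" by (auto simp: lattice_box_def)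
      then have "a $ j < v $ j" by simp
      then have "a $ j + 1 \<le> v $ j"
        using less.prems(1) v by (intro Ints_less_le lattice_nth) (auto simp: lattice_box_def)
      then show "v \<in> lattice_box j0 ?a c" using v j(1) by (auto simp: lattice_box_def E_nth)
    next
      fix v assume v: "v \<in> lattice_box j0 ?a c"
      have "a $ i \<le> v $ i" for i
      proof -
        have "a $ i \<le> ?a $ i" by (simp add: E_nth)
        also have "\<dots> \<le> v $ i" using v unfolding lattice_box_def by blast
        finally show ?thesis .
      qed
      moreover have "?a $ j \<le> v $ j" using v unfolding lattice_box_def by blast
      then have "v $ j \<noteq> a $ j" by (simp add: E_nth)
      ultimately show "v \<in> {v \<in> lattice_box j0 a c. v $ j \<noteq> a $ j}"
        using v j(1) by (auto simp: lattice_box_def E_nth)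
    qed
    have "primitives_extend (kept j0 T \<union> cells j0 T {v \<in> lattice_box j0 a c. v $ j \<noteq> a $ j})
        (kept j0 T \<union> cells j0 T (lattice_box j0 a c))"
    proof (rule primitives_extend_layer[where s = 1])
      fix v assume v: "v \<in> lattice_box j0 a c" "v $ j = a $ j"
      have "a $ i \<le> (v + E j) $ i \<and> (v + E j) $ i \<le> c $ i" for i
      proof -
        have "a $ i \<le> v $ i" "v $ i \<le> c $ i" "p $ i \<le> c $ i" using v(1) c by (auto simp: lattice_box_def)
        then show ?thesis using pj v(2) by (cases "i = j") (auto simp: E_nth)
      qed
      then show "v + 1 *s E j \<in> lattice_box j0 a c" using v j(1) by (auto simp: lattice_box_def E_nth)
      show "v - 1 *s E j \<notin> lattice_box j0 a c"
        using v(2) by (auto simp: lattice_box_def E_nth intro!: exI[of _ j])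
      fix S assume S: "S \<subseteq> T"
      then have S0: "S \<subseteq> {j0}" using T by blast
      define e where "e = (\<Sum>i\<in>S. E i)"
      have e: "e $ j = 0" "0 \<le> e $ i" for i
        using sum_E_subset_singleton[OF S0 j(1)] by (simp_all add: e_def)
      let ?w = "v + e"
      have "slope ?w j \<le> slope a j"
      proof (rule slope_antimono)
        fix i
        have "a $ i \<le> v $ i" using v(1) unfolding lattice_box_def by blast
        then show "a $ i \<le> ?w $ i" using e(2)[of i] by simp
      qed (use v(2) e(1) in simp)
      then have "slope ?w j \<le> 0" using j(3) by simp
      then show "rr G k (v + (\<Sum>i\<in>S. E i) + 1 *s E j) \<le> rr G k (v + (\<Sum>i\<in>S. E i))"
        by (simp add: slope_def e_def)
    qed (use j(1) T in \<open>auto simp: kept_disjoint face_closed_kept\<close>)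
    then show ?thesis using 1 unfolding remove by (blast intro: primitives_extend_trans)
  qed
qed

end

context almost_rational_weights
begin

text \<open>The collapse of a fibre or a slab onto its base point \<open>x\<close> or the edge from \<open>x\<close> to \<open>x + E j0\<close>. It is
  exhausted by boxes around \<open>x\<close> whose corners are themselves end points of ascending and descending
  steps, so that each box collapses onto the preceding one.\<close>

lemma primitives_extend_fibre:
  assumes T: "T = {} \<or> T = {j0}"
    and x: "x \<in> lattice_L" "\<And>j. j \<noteq> j0 \<Longrightarrow> 1 \<le> slope x j" "ascends j0 x"
  shows "primitives_extend (kept j0 T \<union> {(x, T)}) (kept j0 T \<union> cells j0 T (fibre j0 (x $ j0)))"
proof -
  \<comment> \<open>\<open>P\<close> describes the corners of the \<open>n\<close>-th box; \<open>Q\<close> makes the boxes exhaust the fibre.\<close>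
  define P where "P n p \<longleftrightarrow> fst p \<in> lattice_L \<and> snd p \<in> lattice_L \<and> fst p $ j0 = x $ j0 \<and>
      snd p $ j0 = x $ j0 \<and> (\<forall>i. fst p $ i \<le> x $ i) \<and> (\<forall>i. x $ i \<le> snd p $ i) \<and>
      ascends j0 (fst p) \<and> descends j0 (snd p) \<and> (n = 0 \<longrightarrow> p = (x, x))"
    for n :: nat and p
  define Q where "Q p q \<longleftrightarrow> (\<forall>i. i \<noteq> j0 \<longrightarrow> fst q $ i \<le> fst p $ i - 1 \<and> snd p $ i + 1 \<le> snd q $ i)"
    for p q :: "(rat, 'a) vec \<times> (rat, 'a) vec"
  have "\<exists>X. \<forall>n. P n (X n) \<and> Q (X n) (X (Suc n))"
  proof (rule dependent_nat_choice)
    have "P 0 (x, x)" using x descends_if_slope_ge_1[OF x(1,2)] by (simp add: P_def)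
    then show "\<exists>p. P 0 p" ..
  next
    fix p n assume p: "P n p"
    define b where "b = (\<chi> i. if i = j0 then x $ j0 else fst p $ i - 1)"
    define d where "d = (\<chi> i. if i = j0 then x $ j0 else snd p $ i + 1)"
    have "b \<in> lattice_L" "d \<in> lattice_L"
      using p x(1) by (auto simp: P_def b_def d_def lattice_L_def)
    obtain a where a: "a \<in> lattice_L" "a $ j0 = b $ j0" "\<And>i. a $ i \<le> b $ i"
      "\<And>j. j \<noteq> j0 \<Longrightarrow> slope a j \<le> 0"
      using exists_slope_le_0[OF \<open>b \<in> lattice_L\<close>, of j0] by metis
    obtain c where c: "c \<in> lattice_L" "c $ j0 = d $ j0" "\<And>i. d $ i \<le> c $ i"
      "\<And>j. j \<noteq> j0 \<Longrightarrow> 1 \<le> slope c j"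
      using exists_slope_ge_1[OF \<open>d \<in> lattice_L\<close>, of j0] by metis
    have le: "fst p $ i \<le> x $ i" "x $ i \<le> snd p $ i" for i using p by (auto simp: P_def)
    have ac: "a $ i \<le> fst p $ i - 1" "snd p $ i + 1 \<le> c $ i" if "i \<noteq> j0" for i
      using a(3)[of i] c(3)[of i] that by (simp_all add: b_def d_def)
    have "a $ i \<le> x $ i" "x $ i \<le> c $ i" for i
      using ac[of i] le[of i] a(2) c(2) by (cases "i = j0"; simp add: b_def d_def)+
    then have "P (Suc n) (a, c)"
      using a(1,2) c(1,2) ascends_if_slope_le_0[OF a(4)] descends_if_slope_ge_1[OF c(1,4)]
      by (simp add: P_def b_def d_def)
    moreover have "Q p (a, c)" using ac by (simp add: Q_def)
    ultimately show "\<exists>q. P (Suc n) q \<and> Q p q" by blast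
  qed
  then obtain X where X: "\<And>n. P n (X n)" "\<And>n. Q (X n) (X (Suc n))" by blast
  define B where "B n = lattice_box j0 (fst (X n)) (snd (X n))" for n
  define A where "A n = kept j0 T \<union> cells j0 T (B n)" for n
  have "primitives_extend (A n) (A (Suc n))" for n
  proof -
    let ?a = "fst (X n)" and ?c = "snd (X n)" and ?a' = "fst (X (Suc n))" and ?c' = "snd (X (Suc n))"
    note Xn = X(1)[of n, unfolded P_def] and Xs = X(1)[of "Suc n", unfolded P_def]
    have le: "?a' $ i \<le> ?a $ i" "?c $ i \<le> ?c' $ i" for i
      using X(2)[of n] Xn Xs by (cases "i = j0"; force simp: Q_def)+
    have mid: "?a $ i \<le> ?c $ i" "?a $ i \<le> ?c' $ i" for i
      using Xn Xs order_trans by blast+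
    have "primitives_extend (kept j0 T \<union> cells j0 T (lattice_box j0 ?a ?c))
        (kept j0 T \<union> cells j0 T (lattice_box j0 ?a ?c'))"
      using Xn Xs le mid by (intro primitives_extend_up T) auto
    moreover have "primitives_extend (kept j0 T \<union> cells j0 T (lattice_box j0 ?a ?c'))
        (kept j0 T \<union> cells j0 T (lattice_box j0 ?a' ?c'))"
      using Xn Xs le mid by (intro primitives_extend_down T) auto
    ultimately show ?thesis unfolding A_def B_def by (rule primitives_extend_trans)
  qed
  moreover have "face_closed (A n)" for n unfolding A_def by (rule face_closed_kept[OF T])
  ultimately have "primitives_extend (A 0) (\<Union>n. A n)" by (intro primitives_extend_chain)
  moreover have "X 0 = (x, x)" using X(1)[of 0] by (simp add: P_def)
  then have "A 0 = kept j0 T \<union> {(x, T)}"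
    using cells_singleton_box[OF x(1) T] by (simp add: A_def B_def)
  moreover have "(\<Union>n. A n) = kept j0 T \<union> cells j0 T (fibre j0 (x $ j0))"
  proof -
    have "B n \<subseteq> fibre j0 (x $ j0)" for n
      using X(1)[of n] by (auto simp: B_def lattice_box_def fibre_def P_def)
    then have "cells j0 T (B n) \<subseteq> cells j0 T (fibre j0 (x $ j0))" for n
      unfolding cells_def by blast
    moreover have "\<exists>n. c \<in> cells j0 T (B n)" if c: "c \<in> cells j0 T (fibre j0 (x $ j0))" for c
    proof -
      obtain l I where lI: "c = (l, I)" by fastforce
      let ?W = "cube_vertices (l, I - {j0})"
      have far: "fst (X n) $ i \<le> x $ i - of_nat n \<and> x $ i + of_nat n \<le> snd (X n) $ i"
        if "i \<noteq> j0" for n i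
      proof (induction n)
        case 0
        show ?case using \<open>X 0 = (x, x)\<close> by simp
      next
        case (Suc n)
        then show ?case using X(2)[of n] that by (force simp: Q_def)
      qed
      obtain n :: nat where n: "\<And>v i. v \<in> ?W \<Longrightarrow> \<bar>v $ i - x $ i\<bar> \<le> of_nat n"
      proof -
        let ?M = "\<Sum>v\<in>?W. \<Sum>i\<in>UNIV. \<bar>v $ i - x $ i\<bar>"
        have fin: "finite ?W" by (simp add: cube_vertices_def)
        have "\<bar>v $ i - x $ i\<bar> \<le> ?M" if "v \<in> ?W" for v i
        proof -
          have "\<bar>v $ i - x $ i\<bar> \<le> (\<Sum>i\<in>UNIV. \<bar>v $ i - x $ i\<bar>)"
            by (rule member_le_sum) auto
          also have "\<dots> \<le> ?M"
            by (rule member_le_sum[OF that, of "\<lambda>v. \<Sum>i\<in>UNIV. \<bar>v $ i - x $ i\<bar>"])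
              (auto simp: fin intro: sum_nonneg)
          finally show ?thesis .
        qed
        moreover obtain n :: nat where "?M \<le> of_nat n" using real_arch_simple by blast
        ultimately show thesis using that by (meson order_trans)
      qed
      have "?W \<subseteq> B n"
      proof
        fix v assume v: "v \<in> ?W"
        then have vf: "v \<in> lattice_L" "v $ j0 = x $ j0"
          using c by (auto simp: lI cells_def fibre_def)
        have "fst (X n) $ i \<le> v $ i \<and> v $ i \<le> snd (X n) $ i" for i
        proof (cases "i = j0")
          case True
          then show ?thesis using vf(2) X(1)[of n] by (simp add: P_def)
        next
          case False
          then show ?thesis using far[OF False, of n] n[OF v, of i] by (simp add: abs_le_iff)
        qed
        then show "v \<in> B n" using vf X(1)[of n] by (simp add: B_def lattice_box_def P_def)
      qed
      then show ?thesis using c by (auto simp: lI cells_def)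
    qed
    ultimately show ?thesis by (auto simp: A_def)
  qed
  ultimately show ?thesis by simp
qed

end


section \<open>Vanishing\<close>

context weighted_lattice
begin

text \<open>An integral lower bound of the weights.\<close>

definition rr_bound :: int where
  "rr_bound = \<lfloor>form G k k / 8\<rfloor>"

text \<open>The cochain on the lattice points with the value \<open>U\<^bsup>w(l) - r\<^esup> v(n)\<close> at \<open>l\<close>, where \<open>n\<close> is the
  coordinate of \<open>l\<close> at \<open>j0\<close>, \<open>w\<close> the weight and \<open>r\<close> the bound above. The powers of \<open>U\<close> make it a
  cocycle on each fibre.\<close>

definition fibrewise_constant :: "'v \<Rightarrow> (int \<Rightarrow> tower) \<Rightarrow> 'v cube \<Rightarrow> tower" where
  "fibrewise_constant j0 v c =
     (if snd c = {} then U_act (nat \<lfloor>weight G k c - of_int rr_bound\<rfloor>) (v \<lfloor>fst c $ j0\<rfloor>) else 0)"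

lemma weight_point: "weight G k (l, {}) = rr G k l"
  by (simp add: weight_def cube_vertices_def)

lemma coboundary_edge:
  assumes "l \<in> lattice_L"
  shows "coboundary G k \<psi> (l, {j}) = U_act (U_exponent G k (l, {j}) (l + E j, {})) (\<psi> (l + E j, {}))
    - U_act (U_exponent G k (l, {j}) (l, {})) (\<psi> (l, {}))"
proof -
  have empty: "{i. i = j \<and> i < j} = {}" by auto
  show ?thesis unfolding coboundary_apply[OF assms] by (simp add: sign_act_def empty)
qed

lemma coboundary_fibrewise_constant_edge:
  assumes l: "l \<in> lattice_L"
  shows "coboundary G k (fibrewise_constant j0 v) (l, {j})
    = U_act (nat \<lfloor>weight G k (l, {j}) - of_int rr_bound\<rfloor>) (v \<lfloor>(l + E j) $ j0\<rfloor> - v \<lfloor>l $ j0\<rfloor>)"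
proof -
  have "U_act (U_exponent G k (l, {j}) (p, {})) (fibrewise_constant j0 v (p, {}))
    = U_act (nat \<lfloor>weight G k (l, {j}) - of_int rr_bound\<rfloor>) (v \<lfloor>p $ j0\<rfloor>)"
    if p: "(p, {}) \<in> faces (l, {j})" for p
  proof -
    have "p \<in> lattice_L" using faces_lattice[OF p] l by simp
    then obtain a :: int where a: "rr G k p = of_int a"
      using rr_Ints[OF plumbing negdef char] by (blast elim: Ints_cases)
    have "of_int rr_bound \<le> rr G k p"
      using rr_bounded_below[of p] of_int_floor_le order_trans unfolding rr_bound_def by blast
    then have le: "rr_bound \<le> a" by (simp add: a)
    have "weight G k (l, {j}) - of_int rr_bound
        = of_int (int (U_exponent G k (l, {j}) (p, {})) + (a - rr_bound))"
      using U_exponent_face[OF _ p] l by (simp add: weight_point a)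
    then have "nat \<lfloor>weight G k (l, {j}) - of_int rr_bound\<rfloor>
        = U_exponent G k (l, {j}) (p, {}) + nat (a - rr_bound)"
      using le by (simp only: floor_of_int nat_add_distrib of_nat_0_le_iff diff_ge_0_iff_ge nat_int)
    moreover have "nat \<lfloor>weight G k (p, {}) - of_int rr_bound\<rfloor> = nat (a - rr_bound)"
      by (simp add: weight_point a)
    ultimately show ?thesis by (simp add: fibrewise_constant_def U_act_U_act)
  qed
  then show ?thesis
    using l by (simp add: coboundary_edge U_act_diff faces_def)
qed

lemma coboundary_fibrewise_constant_fibre:
  assumes "c \<in> cells j0 {} lattice_L"
  shows "coboundary G k (fibrewise_constant j0 v) c = 0"
proof -
  obtain l I where c: "c = (l, I)" by fastforce
  have l: "l \<in> lattice_L" "j0 \<notin> I" using assms by (auto simp: c cells_def)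
  show ?thesis
  proof (cases "\<exists>j. I = {j}")
    case True
    then obtain j where j: "I = {j}" by blast
    then have "(l + E j) $ j0 = l $ j0" using l(2) by (simp add: E_nth)
    then show ?thesis unfolding c j coboundary_fibrewise_constant_edge[OF l(1)] by simp
  next
    case False
    then have "I - {j} \<noteq> {}" if "j \<in> I" for j using that by blast
    then show ?thesis
      using l(1) by (auto simp: c coboundary_apply fibrewise_constant_def sign_act_simps intro!: sum.neutral)
  qed
qed

end

lemma exists_with_differences:
  fixes u :: "int \<Rightarrow> 'a::ab_group_add"
  shows "\<exists>v. \<forall>n. v (n + 1) - v n = u n"
proof -
  define v where "v n = (if 0 \<le> n then \<Sum>i\<in>{0..<n}. u i else - (\<Sum>i\<in>{n..<0}. u i))" for n
  have "v (n + 1) - v n = u n" for n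
  proof (cases "0 \<le> n")
    case True
    then have "{0..<n + 1} = insert n {0..<n}" by auto
    then show ?thesis using True by (simp add: v_def)
  next
    case False
    then have "{n..<0} = insert n {n + 1..<0}" by auto
    then have "(\<Sum>i\<in>{n..<0}. u i) = u n + (\<Sum>i\<in>{n + 1..<0}. u i)" by simp
    moreover have "v (n + 1) = - (\<Sum>i\<in>{n + 1..<0}. u i)"
      using False by (cases "n = -1") (auto simp: v_def)
    ultimately show ?thesis using False by (simp add: v_def)
  qed
  then show ?thesis by blast
qed

context almost_rational_weights
begin

text \<open>After the fibres, the equations at the edges from the base points \<open>x n\<close> to \<open>x n + E j0\<close> remain to be
  solved before the slabs collapse. The primitive on the fibres can be changed by a fibrewise
  constant cochain given by some \<open>v\<close>. This changes the value of the coboundary at the \<open>n\<close>-th edge by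
  a power of \<open>U\<close> times \<open>v (n + 1) - v n\<close>, and \<open>U\<close> acts surjectively.\<close>

lemma exists_primitive:
  assumes \<phi>: "coboundary G k \<phi> = (\<lambda>_. 0)" and \<phi>0: "\<And>l. \<phi> (l, {}) = 0"
    and outside: "\<And>l I. l \<notin> lattice_L \<Longrightarrow> \<phi> (l, I) = 0"
  shows "\<exists>\<psi>. coboundary G k \<psi> = \<phi>"
proof -
  have "\<exists>x. x \<in> lattice_L \<and> x $ j0 = of_int n \<and> (\<forall>j. j \<noteq> j0 \<longrightarrow> 1 \<le> slope x j) \<and> ascends j0 x"
    for n :: int
    using exists_base_point[of j0 n] by metis
  then obtain x where x: "\<And>n :: int. x n \<in> lattice_L" "\<And>n. x n $ j0 = of_int n"
    "\<And>n j. j \<noteq> j0 \<Longrightarrow> 1 \<le> slope (x n) j" "\<And>n. ascends j0 (x n)" by metis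
  let ?fibres = "cells j0 {} lattice_L"
  have coord: "\<exists>n. p $ j0 = of_int n" if "p \<in> lattice_L" for p
    using lattice_nth[OF that, of j0] by (auto elim: Ints_cases)
  have decompose: "cells j0 T lattice_L = (\<Union>n :: int. cells j0 T (fibre j0 (of_int n)))" for T
  proof
    show "(\<Union>n :: int. cells j0 T (fibre j0 (of_int n))) \<subseteq> cells j0 T lattice_L"
      by (auto simp: cells_def fibre_def)
    show "cells j0 T lattice_L \<subseteq> (\<Union>n :: int. cells j0 T (fibre j0 (of_int n)))"
    proof
      fix c assume c: "c \<in> cells j0 T lattice_L"
      obtain l I where lI: "c = (l, I)" by fastforce
      have "l \<in> lattice_L" using c by (auto simp: lI cells_def)
      then obtain n :: int where "l $ j0 = of_int n" using coord by blast
      moreover have "v $ j0 = l $ j0" if "v \<in> cube_vertices (l, I - {j0})" for v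
        using that by (intro cube_vertices_nth[of v l "I - {j0}"]) auto
      ultimately have "c \<in> cells j0 T (fibre j0 (of_int n))"
        using c by (auto simp: lI cells_def fibre_def)
      then show "c \<in> (\<Union>n :: int. cells j0 T (fibre j0 (of_int n)))" by blast
    qed
  qed
  have disjoint: "cells j0 T (fibre j0 a) \<inter> cells j0 T (fibre j0 b) = {}" if "a \<noteq> b" for T a b
  proof -
    have "fst c $ j0 = a" if "c \<in> cells j0 T (fibre j0 a)" for c a
      using that base_in_cube_vertices[of "fst c" "snd c - {j0}"]
      by (auto simp: cells_def fibre_def)
    then show ?thesis using \<open>a \<noteq> b\<close> by blast
  qed
  have extend: "primitives_extend (kept j0 T \<union> (\<Union>n. {(x n, T)})) (kept j0 T \<union> cells j0 T lattice_L)"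
    if T: "T = {} \<or> T = {j0}" for T
  proof -
    have "primitives_extend (\<Union>n. kept j0 T \<union> {(x n, T)})
        (\<Union>n :: int. kept j0 T \<union> cells j0 T (fibre j0 (of_int n)))"
    proof (rule primitives_extend_Union)
      fix n m :: int
      show "face_closed (kept j0 T \<union> cells j0 T (fibre j0 (of_int n)))"
        by (rule face_closed_kept[OF T])
      show "primitives_extend (kept j0 T \<union> {(x n, T)}) (kept j0 T \<union> cells j0 T (fibre j0 (of_int n)))"
        using primitives_extend_fibre[OF T x(1) x(3) x(4), of n] by (simp add: x(2))
      assume "n \<noteq> m"
      then show "(kept j0 T \<union> cells j0 T (fibre j0 (of_int n)) - (kept j0 T \<union> {(x n, T)}))
          \<inter> (kept j0 T \<union> cells j0 T (fibre j0 (of_int m))) = {}"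
        using disjoint[of "of_int n" "of_int m" T] kept_disjoint[of j0 T] by auto
    qed
    moreover have "(\<Union>n. kept j0 T \<union> {(x n, T)}) = kept j0 T \<union> (\<Union>n. {(x n, T)})"
      "(\<Union>n :: int. kept j0 T \<union> cells j0 T (fibre j0 (of_int n))) = kept j0 T \<union> cells j0 T lattice_L"
      unfolding decompose[of T] by blast+
    ultimately show ?thesis by (simp only:)
  qed
  \<comment> \<open>At the base points there is no equation to solve.\<close>
  have "primitive_on \<phi> (\<lambda>_. 0) (\<Union>n. {(x n, {})})"
    by (auto simp: primitive_on_def coboundary_zero \<phi>0)
  moreover have "primitives_extend (\<Union>n. {(x n, {})}) ?fibres"
    using extend[of "{}"] by (simp add: kept_def)
  ultimately obtain \<psi>1 where \<psi>1: "primitive_on \<phi> \<psi>1 ?fibres"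
    using primitives_extendE[OF _ \<phi>] by metis
  have "\<exists>u. U_act (nat \<lfloor>weight G k (x n, {j0}) - of_int rr_bound\<rfloor>) u
      = \<phi> (x n, {j0}) - coboundary G k \<psi>1 (x n, {j0})" for n
    by (rule U_act_surj)
  then obtain u where u: "\<And>n. U_act (nat \<lfloor>weight G k (x n, {j0}) - of_int rr_bound\<rfloor>) (u n)
      = \<phi> (x n, {j0}) - coboundary G k \<psi>1 (x n, {j0})" by metis
  obtain v where v: "\<And>n. v (n + 1) - v n = u n" using exists_with_differences[of u] by blast
  define \<psi>2 where "\<psi>2 c = \<psi>1 c + fibrewise_constant j0 v c" for c
  have "coboundary G k \<psi>2 (x n, {j0}) = \<phi> (x n, {j0})" for n
  proof -
    have "\<lfloor>(x n + E j0) $ j0\<rfloor> = n + 1" "\<lfloor>x n $ j0\<rfloor> = n" by (simp_all add: x(2) E_nth)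
    then show ?thesis
      unfolding \<psi>2_def[abs_def] coboundary_add coboundary_fibrewise_constant_edge[OF x(1)]
      by (simp only: v u add_diff_eq add_diff_cancel_left')
  qed
  moreover have "coboundary G k \<psi>2 c = \<phi> c" if "c \<in> ?fibres" for c
    unfolding \<psi>2_def[abs_def] coboundary_add coboundary_fibrewise_constant_fibre[OF that]
    using \<psi>1 that by (simp add: primitive_on_def)
  ultimately have "primitive_on \<phi> \<psi>2 (kept j0 {j0} \<union> (\<Union>n. {(x n, {j0})}))"
    by (auto simp: primitive_on_def kept_def)
  moreover have "primitives_extend (kept j0 {j0} \<union> (\<Union>n. {(x n, {j0})}))
      (?fibres \<union> cells j0 {j0} lattice_L)"
    using extend[of "{j0}"] by (simp add: kept_def)
  ultimately obtain \<psi>3 where \<psi>3: "primitive_on \<phi> \<psi>3 (?fibres \<union> cells j0 {j0} lattice_L)"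
    using primitives_extendE[OF _ \<phi>] by metis
  have "coboundary G k \<psi>3 (l, I) = \<phi> (l, I)" for l I
  proof (cases "l \<in> lattice_L")
    case True
    then have "cube_vertices (l, I - {j0}) \<subseteq> lattice_L" by (auto simp: cube_vertices_iff)
    then have "(l, I) \<in> ?fibres \<union> cells j0 {j0} lattice_L" using True by (auto simp: cells_def)
    then show ?thesis using \<psi>3 by (auto simp: primitive_on_def)
  qed (simp add: coboundary_outside outside)
  then show ?thesis by (intro exI[of _ \<psi>3]) auto
qed

end

lemma coboundary_cochains:
  fixes \<psi> :: "'v::{finite,linorder} cube \<Rightarrow> tower"
  assumes "\<psi> \<in> cochains p"
  shows "coboundary G k \<psi> \<in> cochains (Suc p)"
  unfolding cochains_def mem_Collect_eq
proof (intro allI impI)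
  fix c :: "'v cube" assume c: "c \<notin> cubes (Suc p)"
  obtain l I where lI: "c = (l, I)" by fastforce
  show "coboundary G k \<psi> c = 0"
  proof (cases "l \<in> lattice_L")
    case True
    then have I: "card I \<noteq> Suc p" using c by (auto simp: lI cubes_def)
    have "\<psi> (m, I - {j}) = 0" if "j \<in> I" for m j
    proof -
      have "card (I - {j}) \<noteq> p" using I card_Suc_Diff1[OF _ that] by auto
      then show ?thesis using assms by (auto simp: cochains_def cubes_def)
    qed
    then show ?thesis using True by (simp add: lI coboundary_apply sign_act_simps)
  qed (simp add: lI coboundary_outside)
qed

lemma (in almost_rational_weights) cocycle_is_coboundary:
  assumes \<phi>: "\<phi> \<in> cochains (Suc p)" "coboundary G k \<phi> = (\<lambda>_. 0)"
  shows "\<phi> \<in> coboundary G k ` cochains p"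
proof -
  have "\<phi> (l, {}) = 0" "l \<notin> lattice_L \<Longrightarrow> \<phi> (l, I) = 0" for l I
    using \<phi>(1) by (auto simp: cochains_def cubes_def)
  then obtain \<psi> where \<psi>: "coboundary G k \<psi> = \<phi>" using exists_primitive[OF \<phi>(2)] by blast
  define \<psi>' where "\<psi>' c = (if c \<in> cubes p then \<psi> c else 0)" for c
  have \<psi>': "\<psi>' \<in> cochains p" by (simp add: \<psi>'_def cochains_def)
  have "coboundary G k \<psi>' c = \<phi> c" for c
  proof (cases "c \<in> cubes (Suc p)")
    case True
    have "d \<in> cubes p" if "d \<in> faces c" for d
      using that True by (auto simp: faces_def cubes_def)
    then have "coboundary G k \<psi>' c = coboundary G k \<psi> c"
      by (intro coboundary_cong) (simp add: \<psi>'_def)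
    then show ?thesis by (simp add: \<psi>)
  next
    case False
    then show ?thesis using \<phi>(1) coboundary_cochains[OF \<psi>', of G k]
      unfolding cochains_def mem_Collect_eq by metis
  qed
  then have "\<phi> = coboundary G k \<psi>'" by (simp add: fun_eq_iff)
  then show ?thesis using \<psi>' by (rule image_eqI)
qed

lemma (in weighted_lattice) group_cocycle_group: "group (cocycle_group G k q)"
proof (rule groupI)
  show "x \<otimes>\<^bsub>cocycle_group G k q\<^esub> y \<in> carrier (cocycle_group G k q)"
    if "x \<in> carrier (cocycle_group G k q)" "y \<in> carrier (cocycle_group G k q)" for x y
    using that coboundary_add[of G k x y]
    by (auto simp: cocycle_group_def cochains_def fun_eq_iff)
  show "\<one>\<^bsub>cocycle_group G k q\<^esub> \<in> carrier (cocycle_group G k q)"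
    by (simp add: cocycle_group_def cochains_def coboundary_zero)
  show "\<exists>y\<in>carrier (cocycle_group G k q). y \<otimes>\<^bsub>cocycle_group G k q\<^esub> x = \<one>\<^bsub>cocycle_group G k q\<^esub>"
    if "x \<in> carrier (cocycle_group G k q)" for x
    using that coboundary_uminus[of G k x]
    by (intro bexI[of _ "\<lambda>c. - x c"]) (auto simp: cocycle_group_def cochains_def fun_eq_iff)
qed (auto simp: cocycle_group_def add.assoc)

lemma (in group) trivial_group_Mod_carrier: "trivial_group (G Mod carrier G)"
proof -
  have n: "carrier G \<lhd> G"
    by (rule normalI[OF subgroup_self]) (simp add: coset_join2 coset_join3 subgroup_self)
  have "group (G Mod carrier G)" by (rule normal.factorgroup_is_group[OF n])
  moreover have "carrier (G Mod carrier G) = {carrier G}"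
    by (auto simp: FactGroup_def RCOSETS_def coset_join2[OF _ subgroup_self] intro: one_closed)
  ultimately show ?thesis by (simp add: trivial_group_def FactGroup_def)
qed

text \<open>The Riemann-Roch function of the canonical class does not see the Euler number at a vertex
  of multiplicity zero or one.\<close>

lemma rr_canonical_euler_update:
  assumes "plumbing_graph G" "negative_definite G"
    and "plumbing_graph (G\<lparr>euler := (euler G)(j0 := e)\<rparr>)"
    and "negative_definite (G\<lparr>euler := (euler G)(j0 := e)\<rparr>)"
    and "z $ j0 = 0 \<or> z $ j0 = 1"
  shows "rr (G\<lparr>euler := (euler G)(j0 := e)\<rparr>) (canonical (G\<lparr>euler := (euler G)(j0 := e)\<rparr>)) z
    = rr G (canonical G) z"
proof -
  define H where "H = G\<lparr>euler := (euler G)(j0 := e)\<rparr>"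
  have rr: "rr A (canonical A) z = - (\<Sum>j\<in>UNIV. z $ j *
      (form A z (E j) - of_int (euler A j) - 2 + 2 * of_nat (genus A j))) / 2"
    if A: "plumbing_graph A" "negative_definite A" for A :: "'a plumbing"
  proof -
    have "form A z (canonical A) = form A (canonical A) z" by (rule form_commute[OF A(1)])
    then have "rr A (canonical A) z
        = - (\<Sum>j\<in>UNIV. z $ j * form A z (E j) + z $ j * form A (canonical A) (E j)) / 2"
      unfolding rr_def form_add_right sum.distrib form_expand_right[symmetric] by simp
    moreover have "form A (canonical A) (E j) = - of_int (euler A j) - 2 + 2 * of_nat (genus A j)"
      for j
      using canonical_class[OF A(2)] by (simp add: is_canonical_def)
    ultimately show ?thesis by (simp add: algebra_simps)
  qed
  have "z $ j * (form H z (E j) - of_int (euler H j) - 2 + 2 * of_nat (genus H j))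
      = z $ j * (form G z (E j) - of_int (euler G j) - 2 + 2 * of_nat (genus G j))" for j
  proof (cases "j = j0")
    case False
    have "intersection_number H i j = intersection_number G i j" for i
      using False by (simp add: intersection_number_def H_def)
    then show ?thesis using False by (simp add: form_E_right) (simp add: H_def)
  next
    case True
    have "form A z (E j0) = of_int (euler A j0) * z $ j0
        + (\<Sum>i\<in>UNIV - {j0}. of_nat (edges A i j0) * z $ i)" for A :: "'a plumbing"
      unfolding form_E_right
      by (subst sum.remove[of _ j0]) (auto simp: intersection_number_def intro!: sum.cong)
    then show ?thesis using assms(5) True by (auto simp: H_def)
  qed
  then show ?thesis using rr[OF assms(1,2)] rr[OF assms(3,4), folded H_def] by (simp only: H_def[symmetric])
qed

lemma almost_rational_weights_if_almost_rational:
  fixes G :: "'v::{finite,linorder} plumbing"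
  assumes "almost_rational G" "k \<in> Char_L G"
  shows "\<exists>j0. almost_rational_weights G k j0"
proof -
  obtain j0 e where G: "plumbing_graph G" "negative_definite G" "\<And>j. genus G j = 0"
    and rational: "rational_graph (G\<lparr>euler := (euler G)(j0 := e)\<rparr>)"
    using assms(1) unfolding almost_rational_def by blast
  define H where "H = G\<lparr>euler := (euler G)(j0 := e)\<rparr>"
  obtain l where H: "plumbing_graph H" "negative_definite H"
    and l: "is_arg_min (rr H (canonical H)) (\<lambda>x. x \<in> effective_L - {0}) l" "rr H (canonical H) l > 0"
    using rational unfolding rational_graph_def H_def by blast
  have "0 < rr G (canonical G) z"
    if "z \<in> effective_L - {0}" "z $ j0 = 0 \<or> z $ j0 = 1" for z
  proof -
    have "rr H (canonical H) l \<le> rr H (canonical H) z"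
      using l(1) that(1) by (auto simp: is_arg_min_linorder)
    then show ?thesis
      using l(2) rr_canonical_euler_update[OF G(1,2) H[unfolded H_def] that(2)] by (simp add: H_def)
  qed
  then have "almost_rational_weights G k j0"
    using G assms(2) by unfold_locales auto
  then show ?thesis ..
qed

theorem theorem4p3p3:
  fixes G :: "'v::{finite,linorder} plumbing" and k :: "(rat, 'v) vec" and q :: nat
  assumes "almost_rational G" and "k \<in> Char_L G" and "q > 0"
  shows "trivial_group (lattice_cohomology G k q)"
proof -
  obtain j0 where "almost_rational_weights G k j0"
    using almost_rational_weights_if_almost_rational[OF assms(1,2)] by blast
  then interpret almost_rational_weights G k j0 .
  obtain p where q: "q = Suc p" using assms(3) gr0_implies_Suc by blast
  have "carrier (cocycle_group G k q) = coboundaries G k q"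
  proof
    show "carrier (cocycle_group G k q) \<subseteq> coboundaries G k q"
      using cocycle_is_coboundary by (auto simp: cocycle_group_def coboundaries_def q)
    show "coboundaries G k q \<subseteq> carrier (cocycle_group G k q)"
      using coboundary_cochains coboundary_coboundary
      by (fastforce simp: cocycle_group_def coboundaries_def q)
  qed
  then show ?thesis
    using group.trivial_group_Mod_carrier[OF group_cocycle_group[of q]]
    by (simp add: lattice_cohomology_def)
qed

end
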